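(* There are separable operator spaces $X$ and $Y$ such that (1) $X$ does not isomorphically embed into $Y$ (as a Banach space), and (2) the bounded subsets of $X$ and $Y$ are almost completely coarsely equivalent.
   Context: An operator space is a closed linear subspace $X$ of $\mathcal{B}(H)$ for some complex Hilbert space $H$. For $n\in\mathbb{N}$, $\mathrm{M}_n(X)$ is the space of $n\times n$ matrices over $X$ with the norm inherited from $\mathrm{M}_n(\mathcal{B}(H))\cong\mathcal{B}(H^{\oplus n})$. For a (not necessarily linear) map $f\colon X\to Y$, its $n$-th amplification is $f_n\colon\mathrm{M}_n(X)\to\mathrm{M}_n(Y)$, $f_n([x_{ij}])=[f(x_{ij})]$. $B_E$ denotes the closed unit ball of a Banach space $E$. "Isomorphically embed" means: there is a bounded linear map $X\to Y$ that is an isomorphism onto its image. A sequence $\bar f=(F^n\colon A_n\to B_n)_n$ of maps between metric spaces $(A_n,d_n)$, $(B_n,\partial_n)$ is an equi-coarse embedding (the maps are equi-coarse embeddings) if $\omega_{\bar f}(t)<\infty$ for all $t\ge 0$ and $\lim_{t\to\infty}\rho_{\bar f}(t)=\infty$, where $\omega_{\bar f}(t)=\sup_n\sup\{\partial_n(F^n(x),F^n(y))\mid d_n(x,y)\le t\}$ and $\rho_{\bar f}(t)=\inf_n\inf\{\partial_n(F^n(x),F^n(y))\mid d_n(x,y)\ge t\}$ (with $\inf\emptyset=\infty$). The bounded subsets of operator spaces $X$ and $Y$ are almost completely coarsely equivalent if there is a sequence of bijections $(f^n\colon X\to Y)_n$ such that, letting $g^n=(f^n)^{-1}$, the restricted amplifications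 $(f^n_n\restriction_{n\cdot B_{\mathrm{M}_n(X)}}\colon n\cdot B_{\mathrm{M}_n(X)}\to\mathrm{M}_n(Y))_n$ and $(g^n_n\restriction_{n\cdot B_{\mathrm{M}_n(Y)}}\colon n\cdot B_{\mathrm{M}_n(Y)}\to\mathrm{M}_n(X))_n$ are equi-coarse embeddings. *)

theory Defs
  imports
    "HOL-Analysis.Abstract_Metric_Spaces"
    "HOL-Library.Extended_Nonnegative_Real"
    "HOL-Library.Function_Algebras"
    "Jordan_Normal_Form.Matrix"
begin

section \<open>Complex Hilbert spaces\<close>

text \<open>A Hilbert space lives on a subset of an additive group; the scalar multiplication and the
  inner product (linear in the first argument) are part of the data.\<close>

record 'v hilbert =
  hcarrier :: "'v set"
  hscale :: "complex \<Rightarrow> 'v \<Rightarrow> 'v"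
  hinner :: "'v \<Rightarrow> 'v \<Rightarrow> complex"

definition hnorm :: "'v hilbert \<Rightarrow> 'v \<Rightarrow> real" where
  "hnorm H x = sqrt (Re (hinner H x x))"

text \<open>The locale \<^locale>\<open>Metric_space\<close> asks for nonnegativity and symmetry off the carrier as well,
  hence the case distinction here and in the operator distance below.\<close>

definition hdist :: "'v::ab_group_add hilbert \<Rightarrow> 'v \<Rightarrow> 'v \<Rightarrow> real" where
  "hdist H x y = (if x \<in> hcarrier H \<and> y \<in> hcarrier H then hnorm H (x - y) else 0)"

definition hilbert_space :: "'v::ab_group_add hilbert \<Rightarrow> bool" where
  "hilbert_space H \<longleftrightarrow>
     vector_space (hscale H) \<and>
     module.subspace (hscale H) (hcarrier H) \<and>
     (\<forall>x\<in>hcarrier H. \<forall>y\<in>hcarrier H. \<forall>z\<in>hcarrier H.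
        hinner H (x + y) z = hinner H x z + hinner H y z) \<and>
     (\<forall>c. \<forall>x\<in>hcarrier H. \<forall>y\<in>hcarrier H. hinner H (hscale H c x) y = c * hinner H x y) \<and>
     (\<forall>x\<in>hcarrier H. \<forall>y\<in>hcarrier H. hinner H y x = cnj (hinner H x y)) \<and>
     (\<forall>x\<in>hcarrier H. x \<noteq> 0 \<longrightarrow> 0 < Re (hinner H x x)) \<and>
     Metric_space.mcomplete (hcarrier H) (hdist H)"

section \<open>Bounded operators\<close>

text \<open>Operators on \<open>H\<close> vanish off the carrier, so that equality of operators is equality of
  functions; sums and differences are the pointwise ones of \<^theory>\<open>HOL-Library.Function_Algebras\<close>.\<close>

definition bounded_ops :: "'v::ab_group_add hilbert \<Rightarrow> ('v \<Rightarrow> 'v) set" where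
  "bounded_ops H = {T.
     (\<forall>x\<in>hcarrier H. T x \<in> hcarrier H) \<and>
     (\<forall>x\<in>hcarrier H. \<forall>y\<in>hcarrier H. T (x + y) = T x + T y) \<and>
     (\<forall>c. \<forall>x\<in>hcarrier H. T (hscale H c x) = hscale H c (T x)) \<and>
     (\<exists>C. \<forall>x\<in>hcarrier H. hnorm H (T x) \<le> C * hnorm H x) \<and>
     (\<forall>x. x \<notin> hcarrier H \<longrightarrow> T x = 0)}"

definition op_scale :: "'v hilbert \<Rightarrow> complex \<Rightarrow> ('v \<Rightarrow> 'v) \<Rightarrow> 'v \<Rightarrow> 'v" where
  "op_scale H c T = (\<lambda>x. hscale H c (T x))"

definition op_norm :: "'v hilbert \<Rightarrow> ('v \<Rightarrow> 'v) \<Rightarrow> real" where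
  "op_norm H T = (SUP x\<in>{x\<in>hcarrier H. hnorm H x \<le> 1}. hnorm H (T x))"

definition op_dist :: "'v::ab_group_add hilbert \<Rightarrow> ('v \<Rightarrow> 'v) \<Rightarrow> ('v \<Rightarrow> 'v) \<Rightarrow> real" where
  "op_dist H S T = (if S \<in> bounded_ops H \<and> T \<in> bounded_ops H then op_norm H (S - T) else 0)"

definition op_topology :: "'v::ab_group_add hilbert \<Rightarrow> ('v \<Rightarrow> 'v) topology" where
  "op_topology H = Metric_space.mtopology (bounded_ops H) (op_dist H)"

section \<open>Operator spaces and their matrix norms\<close>

definition operator_space :: "'v::ab_group_add hilbert \<Rightarrow> ('v \<Rightarrow> 'v) set \<Rightarrow> bool" where
  "operator_space H X \<longleftrightarrow>
     hilbert_space H \<and> X \<subseteq> bounded_ops H \<and>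
     module.subspace (op_scale H) X \<and> closedin (op_topology H) X"

definition separable_op_space :: "'v::ab_group_add hilbert \<Rightarrow> ('v \<Rightarrow> 'v) set \<Rightarrow> bool" where
  "separable_op_space H X \<longleftrightarrow>
     operator_space H X \<and> separable_space (subtopology (op_topology H) X)"

definition matrices_over :: "nat \<Rightarrow> 'a set \<Rightarrow> 'a mat set" where
  "matrices_over n X = {A \<in> carrier_mat n n. elements_mat A \<subseteq> X}"

text \<open>The unit ball of the \<open>n\<close>-fold Hilbert sum of \<open>H\<close>.\<close>

definition hsum_ball :: "'v hilbert \<Rightarrow> nat \<Rightarrow> 'v vec set" where
  "hsum_ball H n = {\<xi> \<in> carrier_vec n.
     (\<forall>i<n. \<xi> $ i \<in> hcarrier H) \<and> sqrt (\<Sum>i<n. (hnorm H (\<xi> $ i))\<^sup>2) \<le> 1}"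

text \<open>The norm of a matrix of operators, acting on the Hilbert sum by
  \<open>(A \<xi>)\<^sub>i = \<Sum>\<^sub>j A\<^sub>i\<^sub>j \<xi>\<^sub>j\<close>.\<close>

definition mat_op_norm :: "'v::ab_group_add hilbert \<Rightarrow> ('v \<Rightarrow> 'v) mat \<Rightarrow> real" where
  "mat_op_norm H A =
     (SUP \<xi>\<in>hsum_ball H (dim_col A).
        sqrt (\<Sum>i<dim_row A. (hnorm H (\<Sum>j<dim_col A. (A $$ (i, j)) (\<xi> $ j)))\<^sup>2))"

definition mat_op_dist :: "'v::ab_group_add hilbert \<Rightarrow> ('v \<Rightarrow> 'v) mat \<Rightarrow> ('v \<Rightarrow> 'v) mat \<Rightarrow> real" where
  "mat_op_dist H A B = mat_op_norm H (A - B)"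

text \<open>The set \<open>r \<cdot> B\<close> for the closed unit ball \<open>B\<close> of \<open>M\<^sub>n(X)\<close>.\<close>

definition mat_ball :: "'v::ab_group_add hilbert \<Rightarrow> ('v \<Rightarrow> 'v) set \<Rightarrow> nat \<Rightarrow> real \<Rightarrow> ('v \<Rightarrow> 'v) mat set" where
  "mat_ball H X n r = {A \<in> matrices_over n X. mat_op_norm H A \<le> r}"

section \<open>Isomorphic embeddings\<close>

definition bounded_linear_between ::
  "'v::ab_group_add hilbert \<Rightarrow> ('v \<Rightarrow> 'v) set \<Rightarrow> 'w::ab_group_add hilbert \<Rightarrow> ('w \<Rightarrow> 'w) set \<Rightarrow>
   (('v \<Rightarrow> 'v) \<Rightarrow> 'w \<Rightarrow> 'w) \<Rightarrow> bool" where
  "bounded_linear_between H X K Y u \<longleftrightarrow>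
     u \<in> X \<rightarrow> Y \<and>
     (\<forall>S\<in>X. \<forall>T\<in>X. u (S + T) = u S + u T) \<and>
     (\<forall>c. \<forall>T\<in>X. u (op_scale H c T) = op_scale K c (u T)) \<and>
     (\<exists>C. \<forall>T\<in>X. op_norm K (u T) \<le> C * op_norm H T)"

definition isomorphically_embeds ::
  "'v::ab_group_add hilbert \<Rightarrow> ('v \<Rightarrow> 'v) set \<Rightarrow> 'w::ab_group_add hilbert \<Rightarrow> ('w \<Rightarrow> 'w) set \<Rightarrow> bool" where
  "isomorphically_embeds H X K Y \<longleftrightarrow>
     (\<exists>u. bounded_linear_between H X K Y u \<and> inj_on u X \<and>
          bounded_linear_between K (u ` X) H X (inv_into X u))"

section \<open>Equi-coarse embeddings\<close>

text \<open>The moduli take values in \<open>[0, \<infinity>]\<close>; in \<^typ>\<open>ennreal\<close> the infimum of the empty set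
  is \<open>\<infinity>\<close> and its supremum is \<open>0\<close>.\<close>

definition equi_expansion ::
  "nat set \<Rightarrow> (nat \<Rightarrow> 'a set) \<Rightarrow> (nat \<Rightarrow> 'a \<Rightarrow> 'a \<Rightarrow> real) \<Rightarrow> (nat \<Rightarrow> 'b \<Rightarrow> 'b \<Rightarrow> real) \<Rightarrow>
   (nat \<Rightarrow> 'a \<Rightarrow> 'b) \<Rightarrow> real \<Rightarrow> ennreal" where
  "equi_expansion I A d e F t =
     (SUP n\<in>I. SUP (x, y)\<in>{(x, y). x \<in> A n \<and> y \<in> A n \<and> d n x y \<le> t}. ennreal (e n (F n x) (F n y)))"

definition equi_compression ::
  "nat set \<Rightarrow> (nat \<Rightarrow> 'a set) \<Rightarrow> (nat \<Rightarrow> 'a \<Rightarrow> 'a \<Rightarrow> real) \<Rightarrow> (nat \<Rightarrow> 'b \<Rightarrow> 'b \<Rightarrow> real) \<Rightarrow>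
   (nat \<Rightarrow> 'a \<Rightarrow> 'b) \<Rightarrow> real \<Rightarrow> ennreal" where
  "equi_compression I A d e F t =
     (INF n\<in>I. INF (x, y)\<in>{(x, y). x \<in> A n \<and> y \<in> A n \<and> t \<le> d n x y}. ennreal (e n (F n x) (F n y)))"

definition equi_coarse_embedding ::
  "nat set \<Rightarrow> (nat \<Rightarrow> 'a set) \<Rightarrow> (nat \<Rightarrow> 'a \<Rightarrow> 'a \<Rightarrow> real) \<Rightarrow>
   (nat \<Rightarrow> 'b set) \<Rightarrow> (nat \<Rightarrow> 'b \<Rightarrow> 'b \<Rightarrow> real) \<Rightarrow> (nat \<Rightarrow> 'a \<Rightarrow> 'b) \<Rightarrow> bool" where
  "equi_coarse_embedding I A d B e F \<longleftrightarrow>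
     (\<forall>n\<in>I. F n \<in> A n \<rightarrow> B n) \<and>
     (\<forall>t\<ge>0. equi_expansion I A d e F t < \<infinity>) \<and>
     (equi_compression I A d e F \<longlongrightarrow> \<infinity>) at_top"

text \<open>The \<open>n\<close>-th amplification of \<open>f\<close> is \<^term>\<open>map_mat f\<close> on \<open>n \<times> n\<close> matrices.\<close>

definition bounded_almost_completely_coarsely_equivalent ::
  "'v::ab_group_add hilbert \<Rightarrow> ('v \<Rightarrow> 'v) set \<Rightarrow> 'w::ab_group_add hilbert \<Rightarrow> ('w \<Rightarrow> 'w) set \<Rightarrow> bool" where
  "bounded_almost_completely_coarsely_equivalent H X K Y \<longleftrightarrow>
     (\<exists>f :: nat \<Rightarrow> ('v \<Rightarrow> 'v) \<Rightarrow> ('w \<Rightarrow> 'w).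
        (\<forall>n\<ge>1. bij_betw (f n) X Y) \<and>
        equi_coarse_embedding {1..}
          (\<lambda>n. mat_ball H X n (real n)) (\<lambda>n. mat_op_dist H)
          (\<lambda>n. matrices_over n Y) (\<lambda>n. mat_op_dist K)
          (\<lambda>n. map_mat (f n)) \<and>
        equi_coarse_embedding {1..}
          (\<lambda>n. mat_ball K Y n (real n)) (\<lambda>n. mat_op_dist K)
          (\<lambda>n. matrices_over n X) (\<lambda>n. mat_op_dist H)
          (\<lambda>n. map_mat (inv_into X (f n))))"

end

theory Submission
  imports Defs "HOL-Analysis.L2_Norm" "HOL-Analysis.Infinite_Sum" "HOL-Library.Nat_Bijection"
begin

text \<open>
  Write \<open>Q\<close> for the map from \<open>l\<^sub>1\<close>, indexed by the finite subsets \<open>A\<close> of the natural numbers, to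
  \<open>c\<^sub>0\<close> that sends the basis vector of \<open>A\<close> to the indicator function of \<open>A\<close>.  It is onto, and it has a
  nonlinear right inverse of linear growth (\<open>lift_null_seq\<close>).  Let \<open>Z\<^sub>k\<close> be \<open>l\<^sub>1\<close> with the equivalent
  norm \<open>max (2\<^sup>-\<^sup>k \<parallel>z\<parallel>\<^sub>1) \<parallel>Q z\<parallel>\<^sub>\<infinity>\<close>, let \<open>Y\<close> be the \<open>l\<^sub>1\<close>-sum of all \<open>Z\<^sub>k\<close>, and let \<open>X\<close> be the direct sum
  of \<open>c\<^sub>0\<close> and \<open>Y\<close>.

  Why the balls look alike: in \<open>Z\<^sub>k\<close> the value \<open>Q z\<close> can be exchanged for any other \<open>q\<close> by adding the lift of
  \<open>q\<close> and subtracting the lift of \<open>Q z\<close>.  On the ball of radius \<open>n\<close> this costs only \<open>O(n 2\<^sup>-\<^sup>k)\<close> in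
  the first half of the norm.  So the summand \<open>c\<^sub>0\<close> of \<open>X\<close> can be hidden inside \<open>Y\<close>: slot \<open>m\<close> receives the
  \<open>c\<^sub>0\<close>-component, and every later slot receives the quotient part of its predecessor.  This is a
  bijection from \<open>X\<close> to \<open>Y\<close>; it permutes the quotient parts exactly and moves everything else by
  at most \<open>O(n 2\<^sup>-\<^sup>m)\<close> in total.

  Why this survives amplification: both spaces are realised by diagonal operators on the sequence space
  \<open>l\<^sub>2\<close>.  The norm of a matrix of diagonal operators is the supremum over the diagonal positions of
  the norms of scalar \<open>n \<times> n\<close> matrices.  Hence a permutation of positions keeps all matrix norms,
  and an error of \<open>1/n\<^sup>2\<close> in every entry changes the norm of an \<open>n \<times> n\<close> matrix by at most \<open>1\<close>.
  Choosing \<open>m = 3n + 4\<close>, the amplifications are isometric up to an additive constant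
  (\<open>equi_coarse_embedding_diag\<close>, \<open>bounded_equivalence_of_permutations\<close>).

  Why \<open>X\<close> does not embed into \<open>Y\<close>: already \<open>c\<^sub>0\<close> does not.  Let \<open>v\<^sub>i\<close> be the images in \<open>Y\<close> of the unit vectors
  of \<open>c\<^sub>0\<close>; all their finite combinations with coefficients of modulus at most one are uniformly
  bounded.  Choosing signs well turns this into a bound on the \<open>l\<^sub>1\<close>-norm of the pointwise
  supremum of the \<open>v\<^sub>i\<close> (\<open>exists_signs_sum_ge_selection\<close>), and each coordinate of \<open>v\<^sub>i\<close> tends to zero.  By
  dominated convergence \<open>v\<^sub>i\<close> tends to zero in norm (\<open>bounded_multipliers_tendsto_0\<close>), so the map is
  not bounded below.

  For the bookkeeping, a vector is a pair \<open>(y, q)\<close>: \<open>y(k, a)\<close> is \<open>2\<^sup>-\<^sup>k\<close> times the coordinate of the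
  \<open>k\<close>-th summand at the finite set coded by \<open>a\<close>, and the \<open>q(k, \<cdot>)\<close> are the quotient parts, so that
  \<open>Q y(k, \<cdot>) = 2\<^sup>-\<^sup>k q(\<sigma> k, \<cdot>)\<close>.  With \<open>\<sigma> = id\<close> this is \<open>Y\<close>; with \<open>\<sigma> = Suc\<close> the sequence
  \<open>q(0, \<cdot>)\<close> is free, which gives the extra \<open>c\<^sub>0\<close> of \<open>X\<close>.
\<close>

section \<open>Square-summable sequences\<close>

definition ell2 :: "(nat \<Rightarrow> complex) hilbert" where
  "ell2 = \<lparr>hcarrier = {x. summable (\<lambda>i. (cmod (x i))\<^sup>2)},
     hscale = (\<lambda>c x i. c * x i), hinner = (\<lambda>x y. \<Sum>i. x i * cnj (y i))\<rparr>"

lemma hscale_ell2 [simp]: "hscale ell2 c x = (\<lambda>i. c * x i)"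
  by (simp add: ell2_def)

lemma ell2_carrier: "x \<in> hcarrier ell2 \<longleftrightarrow> summable (\<lambda>i. (cmod (x i))\<^sup>2)"
  by (simp add: ell2_def)

lemma summable_ell2_inner:
  assumes "x \<in> hcarrier ell2" "y \<in> hcarrier ell2"
  shows "summable (\<lambda>i. x i * cnj (y i))"
proof (rule summable_comparison_test)
  have "norm (x i * cnj (y i)) \<le> (cmod (x i))\<^sup>2 + (cmod (y i))\<^sup>2" for i
  proof -
    have "0 \<le> cmod (x i) * cmod (y i)" by simp
    then show ?thesis
      using sum_squares_bound[of "cmod (x i)" "cmod (y i)"] unfolding norm_mult complex_mod_cnj by linarith
  qed
  then show "\<exists>N. \<forall>i\<ge>N. norm (x i * cnj (y i)) \<le> (cmod (x i))\<^sup>2 + (cmod (y i))\<^sup>2" by blast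
  show "summable (\<lambda>i. (cmod (x i))\<^sup>2 + (cmod (y i))\<^sup>2)"
    using assms by (intro summable_add) (simp_all add: ell2_carrier)
qed

lemma hinner_self_ell2: "hinner ell2 x x = of_real (\<Sum>i. (cmod (x i))\<^sup>2)" if "x \<in> hcarrier ell2"
proof -
  have "(\<lambda>i. of_real ((cmod (x i))\<^sup>2) :: complex) sums of_real (\<Sum>i. (cmod (x i))\<^sup>2)"
    using that by (simp add: ell2_carrier sums_of_real_iff summable_sums del: of_real_power)
  then show ?thesis
    by (simp add: ell2_def complex_norm_square sums_iff del: of_real_power)
qed

lemma hnorm_ell2: "hnorm ell2 x = sqrt (\<Sum>i. (cmod (x i))\<^sup>2)" if "x \<in> hcarrier ell2"
  using that by (simp add: hnorm_def hinner_self_ell2)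

lemma hnorm_ell2_nonneg [simp]: "0 \<le> hnorm ell2 x" if "x \<in> hcarrier ell2"
  using that by (simp add: hnorm_ell2 ell2_carrier suminf_nonneg)

lemma hnorm_ell2_sq: "(hnorm ell2 x)\<^sup>2 = (\<Sum>i. (cmod (x i))\<^sup>2)" if "x \<in> hcarrier ell2"
  using that by (simp add: hnorm_ell2 ell2_carrier suminf_nonneg)

lemma ell2_partial_sums_le:
  assumes "x \<in> hcarrier ell2"
  shows "(\<Sum>i<n. (cmod (x i))\<^sup>2) \<le> (hnorm ell2 x)\<^sup>2"
  using assms by (auto simp: hnorm_ell2_sq ell2_carrier intro!: sum_le_suminf)

lemma ell2_memI:
  assumes "\<And>n. (\<Sum>i<n. (cmod (x i))\<^sup>2) \<le> r"
  shows "x \<in> hcarrier ell2"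
  unfolding ell2_carrier by (rule summableI_nonneg_bounded[OF _ assms]) simp

text \<open>Membership and norm bounds are tested on partial sums; finite sums are stable under
  coordinatewise limits, which is what completeness needs.\<close>

lemma hnorm_ell2_le:
  assumes "\<And>n. (\<Sum>i<n. (cmod (x i))\<^sup>2) \<le> r\<^sup>2" "0 \<le> r"
  shows "hnorm ell2 x \<le> r"
proof -
  have x: "x \<in> hcarrier ell2" by (rule ell2_memI[OF assms(1)])
  then have "(hnorm ell2 x)\<^sup>2 \<le> r\<^sup>2"
    unfolding hnorm_ell2_sq[OF x] by (intro suminf_le_const assms(1)) (simp add: ell2_carrier)
  then show ?thesis using assms(2) by (rule power2_le_imp_le)
qed

lemma ell2_coord_le: "cmod (x i) \<le> hnorm ell2 x" if "x \<in> hcarrier ell2"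
proof -
  have "(cmod (x i))\<^sup>2 \<le> (\<Sum>j<Suc i. (cmod (x j))\<^sup>2)"
    by (rule member_le_sum[of i "{..<Suc i}" "\<lambda>j. (cmod (x j))\<^sup>2"]) auto
  also have "\<dots> \<le> (hnorm ell2 x)\<^sup>2" by (rule ell2_partial_sums_le[OF that])
  finally show ?thesis by (rule power2_le_imp_le) (simp add: that)
qed

lemma ell2_add:
  assumes "x \<in> hcarrier ell2" "y \<in> hcarrier ell2"
  shows "x + y \<in> hcarrier ell2" "hnorm ell2 (x + y) \<le> hnorm ell2 x + hnorm ell2 y"
proof -
  have L: "L2_set (\<lambda>i. cmod (z i)) {..<n} \<le> hnorm ell2 z" if "z \<in> hcarrier ell2" for z n
    unfolding L2_set_def using that by (intro real_le_lsqrt) (auto simp: ell2_partial_sums_le sum_nonneg)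
  have le: "(\<Sum>i<n. (cmod ((x + y) i))\<^sup>2) \<le> (hnorm ell2 x + hnorm ell2 y)\<^sup>2" for n
  proof -
    have "L2_set (\<lambda>i. cmod ((x + y) i)) {..<n} \<le> L2_set (\<lambda>i. cmod (x i) + cmod (y i)) {..<n}"
      by (rule L2_set_mono) (auto simp: norm_triangle_ineq)
    also have "\<dots> \<le> L2_set (\<lambda>i. cmod (x i)) {..<n} + L2_set (\<lambda>i. cmod (y i)) {..<n}"
      by (rule L2_set_triangle_ineq)
    also have "\<dots> \<le> hnorm ell2 x + hnorm ell2 y" using L assms by (simp add: add_mono)
    finally show ?thesis
      unfolding L2_set_def by (simp add: sqrt_le_D)
  qed
  show "x + y \<in> hcarrier ell2" by (rule ell2_memI[OF le])
  show "hnorm ell2 (x + y) \<le> hnorm ell2 x + hnorm ell2 y"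
    by (rule hnorm_ell2_le[OF le]) (simp add: assms)
qed

lemma ell2_scale:
  assumes "x \<in> hcarrier ell2"
  shows "(\<lambda>i. c * x i) \<in> hcarrier ell2" "hnorm ell2 (\<lambda>i. c * x i) = cmod c * hnorm ell2 x"
proof -
  show *: "(\<lambda>i. c * x i) \<in> hcarrier ell2"
    using assms by (simp add: ell2_carrier norm_mult power_mult_distrib summable_mult)
  show "hnorm ell2 (\<lambda>i. c * x i) = cmod c * hnorm ell2 x"
    using assms unfolding hnorm_ell2[OF *] hnorm_ell2[OF assms]
    by (simp add: norm_mult power_mult_distrib suminf_mult ell2_carrier real_sqrt_mult)
qed

lemma ell2_zero [simp]: "0 \<in> hcarrier ell2" "hnorm ell2 0 = 0"
  by (simp_all add: ell2_carrier hnorm_def ell2_def)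

lemma ell2_diff:
  assumes "x \<in> hcarrier ell2" "y \<in> hcarrier ell2"
  shows "x - y \<in> hcarrier ell2" "hnorm ell2 (x - y) \<le> hnorm ell2 x + hnorm ell2 y"
proof -
  have eq: "x - y = x + (\<lambda>i. (-1) * y i)" by (simp add: fun_eq_iff)
  show "x - y \<in> hcarrier ell2" "hnorm ell2 (x - y) \<le> hnorm ell2 x + hnorm ell2 y"
    unfolding eq using ell2_add[OF assms(1) ell2_scale(1)[OF assms(2), of "-1"]]
      ell2_scale(2)[OF assms(2), of "-1"] by simp_all
qed

lemma hnorm_ell2_eq_0: "hnorm ell2 x = 0 \<longleftrightarrow> x = 0" if "x \<in> hcarrier ell2"
proof
  show "x = 0" if "hnorm ell2 x = 0"
    using ell2_coord_le[OF \<open>x \<in> hcarrier ell2\<close>] that by (simp add: fun_eq_iff)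
qed simp

lemma hnorm_ell2_minus_commute: "hnorm ell2 (x - y) = hnorm ell2 (y - x)"
  if "x \<in> hcarrier ell2" "y \<in> hcarrier ell2"
  using ell2_diff(1)[OF that] ell2_diff(1)[OF that(2,1)]
  by (simp add: hnorm_ell2 norm_minus_commute)

lemma hnorm_ell2_triangle: "hnorm ell2 (x - z) \<le> hnorm ell2 (x - y) + hnorm ell2 (y - z)"
  if "x \<in> hcarrier ell2" "y \<in> hcarrier ell2" "z \<in> hcarrier ell2"
  using ell2_add(2)[OF ell2_diff(1)[OF that(1,2)] ell2_diff(1)[OF that(2,3)]] by simp

lemma Metric_space_ell2: "Metric_space (hcarrier ell2) (hdist ell2)"
proof
  show "0 \<le> hdist ell2 x y" for x y by (auto simp: hdist_def ell2_diff)
  show "hdist ell2 x y = hdist ell2 y x" for x y by (auto simp: hdist_def hnorm_ell2_minus_commute)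
  show "hdist ell2 x y = 0 \<longleftrightarrow> x = y" if "x \<in> hcarrier ell2" "y \<in> hcarrier ell2" for x y
    using that by (auto simp: hdist_def hnorm_ell2_eq_0 ell2_diff)
  show "hdist ell2 x z \<le> hdist ell2 x y + hdist ell2 y z"
    if "x \<in> hcarrier ell2" "y \<in> hcarrier ell2" "z \<in> hcarrier ell2" for x y z
    using that by (auto simp: hdist_def hnorm_ell2_triangle)
qed

text \<open>A Cauchy sequence converges coordinatewise, and the bound on the partial sums of the
  differences passes to the limit in the second index.\<close>

lemma mcomplete_ell2: "Metric_space.mcomplete (hcarrier ell2) (hdist ell2)"
proof -
  interpret Metric_space "hcarrier ell2" "hdist ell2" by (rule Metric_space_ell2)
  show ?thesis
    unfolding mcomplete_def
  proof (intro allI impI)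
    fix s assume s: "MCauchy s"
    then have sc: "s n \<in> hcarrier ell2" for n by (auto simp: MCauchy_def)
    have ca: "\<exists>N. \<forall>m\<ge>N. \<forall>n\<ge>N. hnorm ell2 (s m - s n) < e" if "e > 0" for e
      using s that sc unfolding MCauchy_def hdist_def by simp
    have "Cauchy (\<lambda>n. s n i)" for i
    proof (rule metric_CauchyI)
      fix e :: real assume "e > 0"
      then obtain N where N: "\<forall>m\<ge>N. \<forall>n\<ge>N. hnorm ell2 (s m - s n) < e" using ca by blast
      have "dist (s m i) (s n i) < e" if "m \<ge> N" "n \<ge> N" for m n
        using ell2_coord_le[OF ell2_diff(1)[OF sc sc], of m n i] N that by (fastforce simp: dist_norm)
      then show "\<exists>N. \<forall>m\<ge>N. \<forall>n\<ge>N. dist (s m i) (s n i) < e" by blast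
    qed
    then have "\<forall>i. \<exists>l. (\<lambda>n. s n i) \<longlonglongrightarrow> l" by (simp add: Cauchy_convergent_iff convergent_def)
    then obtain x where x: "\<And>i. (\<lambda>n. s n i) \<longlonglongrightarrow> x i" by metis
    have est: "\<exists>N. \<forall>n\<ge>N. s n - x \<in> hcarrier ell2 \<and> hnorm ell2 (s n - x) \<le> e" if "e > 0" for e
    proof -
      obtain N where N: "\<forall>m\<ge>N. \<forall>n\<ge>N. hnorm ell2 (s m - s n) < e" using ca[OF \<open>e > 0\<close>] by blast
      have "(\<Sum>i<k. (cmod ((s n - x) i))\<^sup>2) \<le> e\<^sup>2" if "n \<ge> N" for n k
      proof (rule Lim_bounded)
        show "(\<lambda>m. \<Sum>i<k. (cmod ((s n - s m) i))\<^sup>2) \<longlonglongrightarrow> (\<Sum>i<k. (cmod ((s n - x) i))\<^sup>2)"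
          by (auto intro!: tendsto_intros x)
        show "\<forall>m\<ge>N. (\<Sum>i<k. (cmod ((s n - s m) i))\<^sup>2) \<le> e\<^sup>2"
        proof (intro allI impI)
          fix m assume "m \<ge> N"
          then have "hnorm ell2 (s n - s m) \<le> e" using N that by fastforce
          then have "(hnorm ell2 (s n - s m))\<^sup>2 \<le> e\<^sup>2"
            by (intro power_mono) (simp_all add: ell2_diff sc)
          with ell2_partial_sums_le[OF ell2_diff(1)[OF sc sc], of n m k]
          show "(\<Sum>i<k. (cmod ((s n - s m) i))\<^sup>2) \<le> e\<^sup>2" by linarith
        qed
      qed
      note le = this
      show ?thesis
      proof (intro exI[of _ N] allI impI conjI)
        fix n assume n: "n \<ge> N"
        show "s n - x \<in> hcarrier ell2" by (rule ell2_memI[OF le[OF n]])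
        show "hnorm ell2 (s n - x) \<le> e" using \<open>e > 0\<close> by (intro hnorm_ell2_le[OF le[OF n]]) simp
      qed
    qed
    from est[of 1] obtain N where "s N - x \<in> hcarrier ell2" by auto
    from ell2_diff(1)[OF sc[of N] this] have xc: "x \<in> hcarrier ell2" by simp
    have "limitin mtopology s x sequentially"
      unfolding limit_metric_sequentially
    proof (intro conjI allI impI xc)
      fix e :: real assume "e > 0"
      then obtain N where "\<forall>n\<ge>N. hnorm ell2 (s n - x) \<le> e / 2" using est[of "e/2"] by auto
      then have "\<forall>n\<ge>N. hnorm ell2 (s n - x) < e" using \<open>e > 0\<close> by fastforce
      then show "\<exists>N. \<forall>n\<ge>N. s n \<in> hcarrier ell2 \<and> hdist ell2 (s n) x < e"
        using sc xc by (auto simp: hdist_def)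
    qed
    then show "\<exists>x. limitin mtopology s x sequentially" by blast
  qed
qed

lemma vector_space_ell2: "vector_space (hscale ell2)"
  by unfold_locales (auto simp: fun_eq_iff algebra_simps)

lemma hilbert_space_ell2: "hilbert_space ell2"
proof -
  interpret vector_space "hscale ell2" by (rule vector_space_ell2)
  have "subspace (hcarrier ell2)"
    unfolding subspace_def by (simp add: ell2_add ell2_scale)
  moreover have "hinner ell2 (x + y) z = hinner ell2 x z + hinner ell2 y z"
    if "x \<in> hcarrier ell2" "y \<in> hcarrier ell2" "z \<in> hcarrier ell2" for x y z
    using suminf_add[OF summable_ell2_inner[OF that(1,3)] summable_ell2_inner[OF that(2,3)]]
    by (simp add: ell2_def algebra_simps)
  moreover have "hinner ell2 (hscale ell2 c x) y = c * hinner ell2 x y"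
    if "x \<in> hcarrier ell2" "y \<in> hcarrier ell2" for c x y
    using suminf_mult[OF summable_ell2_inner[OF that], of c]
    by (simp add: ell2_def algebra_simps)
  moreover have "hinner ell2 y x = cnj (hinner ell2 x y)"
    if "x \<in> hcarrier ell2" "y \<in> hcarrier ell2" for x y
  proof -
    have "(\<lambda>i. x i * cnj (y i)) sums hinner ell2 x y"
      using summable_ell2_inner[OF that] by (simp add: ell2_def summable_sums)
    then have "(\<lambda>i. cnj (x i * cnj (y i))) sums cnj (hinner ell2 x y)"
      by (simp only: sums_cnj)
    then show ?thesis by (simp add: ell2_def sums_iff mult.commute)
  qed
  moreover have "0 < Re (hinner ell2 x x)" if "x \<in> hcarrier ell2" "x \<noteq> 0" for x
  proof -
    have "0 < (hnorm ell2 x)\<^sup>2" using that hnorm_ell2_eq_0 by simp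
    then show ?thesis by (simp add: hnorm_ell2_sq that hinner_self_ell2)
  qed
  ultimately show ?thesis
    unfolding hilbert_space_def using vector_space_ell2 mcomplete_ell2 by blast
qed

section \<open>Diagonal operators\<close>

text \<open>Outside the Hilbert space the operator is zero, as \<^const>\<open>bounded_ops\<close>
  demands.\<close>

definition diag :: "(nat \<Rightarrow> complex) \<Rightarrow> (nat \<Rightarrow> complex) \<Rightarrow> nat \<Rightarrow> complex" where
  "diag a = (\<lambda>x. if x \<in> hcarrier ell2 then (\<lambda>i. a i * x i) else 0)"

definition bounded_seqs :: "(nat \<Rightarrow> complex) set" where
  "bounded_seqs = {a. \<exists>r. \<forall>i. cmod (a i) \<le> r}"

definition unit_seq :: "nat \<Rightarrow> nat \<Rightarrow> complex" where
  "unit_seq t = (\<lambda>i. if i = t then 1 else 0)"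

lemma unit_seq_ell2 [simp]: "unit_seq t \<in> hcarrier ell2" "hnorm ell2 (unit_seq t) = 1"
proof -
  have eq: "(\<lambda>i. (cmod (unit_seq t i))\<^sup>2) = (\<lambda>i. if i = t then 1 else 0)"
    by (auto simp: unit_seq_def)
  have s: "(\<lambda>i. if i = t then 1 else 0 :: real) sums 1"
    using sums_single[of t "\<lambda>_. 1::real"] by simp
  show "unit_seq t \<in> hcarrier ell2"
    unfolding ell2_carrier eq using s by (rule sums_summable)
  then show "hnorm ell2 (unit_seq t) = 1"
    unfolding hnorm_ell2[OF \<open>unit_seq t \<in> hcarrier ell2\<close>] eq sums_unique[OF s, symmetric] by simp
qed

lemma diag_bound:
  assumes "\<And>i. cmod (a i) \<le> r" "x \<in> hcarrier ell2"
  shows "diag a x \<in> hcarrier ell2" "hnorm ell2 (diag a x) \<le> r * hnorm ell2 x"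
proof -
  have r: "0 \<le> r" using norm_ge_zero assms(1) by (rule order_trans)
  have le: "(\<Sum>i<n. (cmod (diag a x i))\<^sup>2) \<le> (r * hnorm ell2 x)\<^sup>2" for n
  proof -
    have "(\<Sum>i<n. (cmod (diag a x i))\<^sup>2) \<le> (\<Sum>i<n. r\<^sup>2 * (cmod (x i))\<^sup>2)"
      using assms r by (auto simp: diag_def norm_mult power_mult_distrib intro!: sum_mono mult_right_mono power_mono)
    also have "\<dots> = r\<^sup>2 * (\<Sum>i<n. (cmod (x i))\<^sup>2)" by (simp add: sum_distrib_left)
    also have "\<dots> \<le> r\<^sup>2 * (hnorm ell2 x)\<^sup>2"
      by (intro mult_left_mono ell2_partial_sums_le assms) simp
    finally show ?thesis by (simp add: power_mult_distrib)
  qed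
  show "diag a x \<in> hcarrier ell2" by (rule ell2_memI[OF le])
  show "hnorm ell2 (diag a x) \<le> r * hnorm ell2 x"
    by (rule hnorm_ell2_le[OF le]) (simp add: r assms)
qed

lemma diag_bounded_ops: "diag a \<in> bounded_ops ell2" if a: "a \<in> bounded_seqs"
proof -
  obtain r where r: "\<And>i. cmod (a i) \<le> r" using a by (auto simp: bounded_seqs_def)
  show ?thesis
    unfolding bounded_ops_def
  proof (intro CollectI conjI ballI allI impI exI[of _ r])
    show "diag a x \<in> hcarrier ell2" "hnorm ell2 (diag a x) \<le> r * hnorm ell2 x"
      if "x \<in> hcarrier ell2" for x using diag_bound[of a r x] r that by auto
    show "diag a (x + y) = diag a x + diag a y" if "x \<in> hcarrier ell2" "y \<in> hcarrier ell2" for x y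
      using that by (simp add: diag_def ell2_add fun_eq_iff algebra_simps)
    show "diag a (hscale ell2 c x) = hscale ell2 c (diag a x)" if "x \<in> hcarrier ell2" for c x
      using that by (simp add: diag_def ell2_scale fun_eq_iff algebra_simps)
    show "diag a x = 0" if "x \<notin> hcarrier ell2" for x
      using that by (simp add: diag_def)
  qed
qed

lemma diag_unit_seq [simp]: "diag a (unit_seq t) t = a t"
  unfolding diag_def using unit_seq_ell2(1)[of t] by (simp add: unit_seq_def)

lemma diag_inject [simp]: "diag a = diag b \<longleftrightarrow> a = b"
  by (metis diag_unit_seq ext)

lemma diag_add: "diag a + diag b = diag (a + b)"
  by (auto simp: diag_def fun_eq_iff algebra_simps)

lemma diag_diff: "diag a - diag b = diag (a - b)"
  by (auto simp: diag_def fun_eq_iff algebra_simps)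

lemma diag_scale: "op_scale ell2 c (diag a) = diag (\<lambda>i. c * a i)"
  by (auto simp: diag_def op_scale_def fun_eq_iff algebra_simps)

lemma diag_zero: "diag 0 = 0"
  by (auto simp: diag_def fun_eq_iff)

lemma bounded_ops_carrier: "T x \<in> hcarrier ell2" if "T \<in> bounded_ops ell2"
proof (cases "x \<in> hcarrier ell2")
  case False
  then have "T x = 0" using that by (auto simp: bounded_ops_def)
  then show ?thesis by simp
qed (use that in \<open>auto simp: bounded_ops_def\<close>)

lemma bounded_ops_scale: "T (\<lambda>i. c * x i) = (\<lambda>i. c * T x i)"
  if "T \<in> bounded_ops ell2" "x \<in> hcarrier ell2"
  using that by (simp add: bounded_ops_def)

lemma op_norm_bdd:
  assumes "T \<in> bounded_ops ell2"
  shows "bdd_above ((\<lambda>x. hnorm ell2 (T x)) ` {x \<in> hcarrier ell2. hnorm ell2 x \<le> 1})"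
proof -
  obtain C where C: "\<And>x. x \<in> hcarrier ell2 \<Longrightarrow> hnorm ell2 (T x) \<le> C * hnorm ell2 x"
    using assms unfolding bounded_ops_def by blast
  show ?thesis
  proof (rule bdd_aboveI2)
    fix x assume x: "x \<in> {x \<in> hcarrier ell2. hnorm ell2 x \<le> 1}"
    then have "C * hnorm ell2 x \<le> \<bar>C\<bar> * 1"
      by (intro mult_mono) auto
    with C[of x] x show "hnorm ell2 (T x) \<le> \<bar>C\<bar>" by auto
  qed
qed

lemma op_norm_bound:
  assumes T: "T \<in> bounded_ops ell2" and x: "x \<in> hcarrier ell2"
  shows "hnorm ell2 (T x) \<le> op_norm ell2 T * hnorm ell2 x"
proof (cases "x = 0")
  case True
  have "T 0 = 0" using bounded_ops_scale[OF T ell2_zero(1), of 0] by (simp add: fun_eq_iff zero_fun_def)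
  then show ?thesis using True by simp
next
  case False
  then have pos: "hnorm ell2 x > 0" using hnorm_ell2_eq_0[OF x] hnorm_ell2_nonneg[OF x] by linarith
  define c where "c = complex_of_real (1 / hnorm ell2 x)"
  have c: "cmod c = 1 / hnorm ell2 x" using pos by (simp add: c_def norm_divide)
  have y: "(\<lambda>i. c * x i) \<in> hcarrier ell2" "hnorm ell2 (\<lambda>i. c * x i) = 1"
    using ell2_scale[OF x, of c] c pos by simp_all
  have "hnorm ell2 (T (\<lambda>i. c * x i)) \<le> op_norm ell2 T"
    unfolding op_norm_def using y by (intro cSUP_upper op_norm_bdd T) simp
  also have "hnorm ell2 (T (\<lambda>i. c * x i)) = hnorm ell2 (T x) / hnorm ell2 x"
    unfolding bounded_ops_scale[OF T x] using ell2_scale(2)[OF bounded_ops_carrier[OF T]] c by simp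
  finally show ?thesis using pos by (simp add: field_simps)
qed

lemma op_norm_le:
  assumes "\<And>x. x \<in> hcarrier ell2 \<Longrightarrow> hnorm ell2 x \<le> 1 \<Longrightarrow> hnorm ell2 (T x) \<le> r"
  shows "op_norm ell2 T \<le> r"
  unfolding op_norm_def using assms ell2_zero by (intro cSUP_least) (auto intro!: exI[of _ 0])

lemma op_norm_nonneg: "0 \<le> op_norm ell2 T" if "T \<in> bounded_ops ell2"
  using op_norm_bound[OF that unit_seq_ell2(1)[of 0]] hnorm_ell2_nonneg[OF bounded_ops_carrier[OF that, of "unit_seq 0"]]
  by simp

lemma op_norm_coord: "cmod (T x i) \<le> op_norm ell2 T * hnorm ell2 x"
  if "T \<in> bounded_ops ell2" "x \<in> hcarrier ell2"
  using ell2_coord_le[OF bounded_ops_carrier[OF that(1)]] op_norm_bound[OF that] by (rule order_trans)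

lemma op_norm_diag_le: "op_norm ell2 (diag a) \<le> r" if "\<And>i. cmod (a i) \<le> r"
proof (rule op_norm_le)
  fix x assume x: "x \<in> hcarrier ell2" "hnorm ell2 x \<le> 1"
  have "0 \<le> r" using norm_ge_zero that by (rule order_trans)
  then have "r * hnorm ell2 x \<le> r * 1" using x by (intro mult_left_mono)
  with diag_bound(2)[of a r, OF that x(1)] show "hnorm ell2 (diag a x) \<le> r" by simp
qed

lemma coord_le_op_norm_diag: "cmod (a i) \<le> op_norm ell2 (diag a)" if "a \<in> bounded_seqs"
  using op_norm_coord[OF diag_bounded_ops[OF that] unit_seq_ell2(1), of i i] by simp

lemma bounded_ops_diff: "S - T \<in> bounded_ops ell2"
  if S: "S \<in> bounded_ops ell2" and T: "T \<in> bounded_ops ell2"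
  unfolding bounded_ops_def
proof (intro CollectI conjI ballI allI impI exI[of _ "op_norm ell2 S + op_norm ell2 T"])
  fix x assume x: "x \<in> hcarrier ell2"
  show "(S - T) x \<in> hcarrier ell2"
    using bounded_ops_carrier[OF S] bounded_ops_carrier[OF T] by (simp add: ell2_diff)
  show "hnorm ell2 ((S - T) x) \<le> (op_norm ell2 S + op_norm ell2 T) * hnorm ell2 x"
    using ell2_diff(2)[OF bounded_ops_carrier[OF S] bounded_ops_carrier[OF T], of x x]
      op_norm_bound[OF S x] op_norm_bound[OF T x] by (simp add: algebra_simps)
  show "(S - T) (hscale ell2 c x) = hscale ell2 c ((S - T) x)" for c
    using bounded_ops_scale[OF S x] bounded_ops_scale[OF T x] by (simp add: fun_eq_iff algebra_simps)
  show "(S - T) (x + y) = (S - T) x + (S - T) y" if "y \<in> hcarrier ell2" for y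
  proof -
    have "S (x + y) = S x + S y" "T (x + y) = T x + T y"
      using S T x that by (auto simp: bounded_ops_def)
    then show ?thesis by simp
  qed
next
  fix x assume "x \<notin> hcarrier ell2"
  then have "S x = 0" "T x = 0" using S T by (auto simp: bounded_ops_def)
  then show "(S - T) x = 0" by simp
qed

lemma op_norm_minus_commute: "op_norm ell2 (S - T) = op_norm ell2 (T - S)"
  if "S \<in> bounded_ops ell2" "T \<in> bounded_ops ell2"
  unfolding op_norm_def using hnorm_ell2_minus_commute[OF bounded_ops_carrier[OF that(1)] bounded_ops_carrier[OF that(2)]]
  by simp

lemma Metric_space_op: "Metric_space (bounded_ops ell2) (op_dist ell2)"
proof
  show "0 \<le> op_dist ell2 S T" for S T
    by (simp add: op_dist_def op_norm_nonneg bounded_ops_diff)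
  show "op_dist ell2 S T = op_dist ell2 T S" for S T
    by (auto simp: op_dist_def op_norm_minus_commute)
  show "op_dist ell2 S T = 0 \<longleftrightarrow> S = T" if S: "S \<in> bounded_ops ell2" and T: "T \<in> bounded_ops ell2" for S T
  proof
    assume "op_dist ell2 S T = 0"
    then have 0: "op_norm ell2 (S - T) = 0" using that by (simp add: op_dist_def)
    show "S = T"
    proof (rule ext)
      fix x
      show "S x = T x"
      proof (cases "x \<in> hcarrier ell2")
        case True
        then show ?thesis
          using op_norm_coord[OF bounded_ops_diff[OF S T] True] 0 by (simp add: fun_eq_iff)
      next
        case False
        then have "S x = 0" "T x = 0" using S T by (auto simp: bounded_ops_def)
        then show ?thesis by simp
      qed
    qed
  next
    assume "S = T"
    then have "op_norm ell2 (S - T) \<le> 0" by (intro op_norm_le) simp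
    with op_norm_nonneg[OF bounded_ops_diff[OF S T]] S T show "op_dist ell2 S T = 0"
      by (simp add: op_dist_def)
  qed
  show "op_dist ell2 R T \<le> op_dist ell2 R S + op_dist ell2 S T"
    if R: "R \<in> bounded_ops ell2" and S: "S \<in> bounded_ops ell2" and T: "T \<in> bounded_ops ell2" for R S T
  proof -
    have "op_norm ell2 (R - T) \<le> op_norm ell2 (R - S) + op_norm ell2 (S - T)"
    proof (rule op_norm_le)
      fix x assume x: "x \<in> hcarrier ell2" "hnorm ell2 x \<le> 1"
      have "hnorm ell2 ((R - T) x) \<le> hnorm ell2 ((R - S) x) + hnorm ell2 ((S - T) x)"
        using hnorm_ell2_triangle[OF bounded_ops_carrier[OF R] bounded_ops_carrier[OF S] bounded_ops_carrier[OF T]]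
        by simp
      also have "\<dots> \<le> op_norm ell2 (R - S) * hnorm ell2 x + op_norm ell2 (S - T) * hnorm ell2 x"
        by (intro add_mono op_norm_bound bounded_ops_diff R S T x)
      also have "\<dots> \<le> op_norm ell2 (R - S) * 1 + op_norm ell2 (S - T) * 1"
        by (intro add_mono mult_left_mono op_norm_nonneg bounded_ops_diff R S T x)
      finally show "hnorm ell2 ((R - T) x) \<le> op_norm ell2 (R - S) + op_norm ell2 (S - T)" by simp
    qed
    then show ?thesis using that by (simp add: op_dist_def)
  qed
qed

text \<open>Diagonal operators determine their sequences by evaluation at the unit vectors, so an
  operator that is a norm limit of diagonal operators is diagonal, and its diagonal is a uniform
  limit.\<close>

lemma closedin_diag:
  assumes V: "V \<subseteq> bounded_seqs"
    and closed: "\<And>a. (\<And>e. e > 0 \<Longrightarrow> \<exists>b\<in>V. \<forall>i. cmod (a i - b i) \<le> e) \<Longrightarrow> a \<in> V"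
  shows "closedin (op_topology ell2) (diag ` V)"
proof -
  interpret Metric_space "bounded_ops ell2" "op_dist ell2" by (rule Metric_space_op)
  have "\<exists>r>0. disjnt (diag ` V) (mball T r)" if T: "T \<in> bounded_ops ell2" "T \<notin> diag ` V" for T
  proof (rule ccontr)
    assume "\<not> ?thesis"
    then have "\<exists>b\<in>V. diag b \<in> mball T e" if "e > 0" for e
      using that by (auto simp: disjnt_iff)
    then have near: "\<exists>b\<in>V. op_norm ell2 (diag b - T) < e" if "e > 0" for e
      using that T V diag_bounded_ops op_norm_minus_commute[OF _ T(1)]
      by (fastforce simp: op_dist_def)
    define a where "a = (\<lambda>t. T (unit_seq t) t)"
    have ab: "cmod (a i - b i) \<le> op_norm ell2 (diag b - T)" if "b \<in> V" for b i
      using op_norm_coord[OF bounded_ops_diff[OF diag_bounded_ops T(1)], of b "unit_seq i" i] V that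
      by (auto simp: a_def norm_minus_commute)
    have "a \<in> V"
    proof (rule closed)
      fix e :: real assume "e > 0"
      then obtain b where "b \<in> V" "op_norm ell2 (diag b - T) < e" using near by blast
      then show "\<exists>b\<in>V. \<forall>i. cmod (a i - b i) \<le> e" using ab by (meson less_imp_le order_trans)
    qed
    moreover have "T = diag a"
    proof (rule ext)
      fix x
      show "T x = diag a x"
      proof (cases "x \<in> hcarrier ell2")
        case False
        then have "T x = 0" using T by (auto simp: bounded_ops_def)
        then show ?thesis using False by (simp add: diag_def)
      next
        case x: True
        have "cmod (T x i - a i * x i) \<le> 0 + e" if "e > 0" for i e
        proof -
          \<comment> \<open>The added one keeps the denominator positive when \<open>x\<close> is zero.\<close>
          define d where "d = e / (2 * (hnorm ell2 x + 1))"
          have hx: "0 \<le> hnorm ell2 x" using x by simp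
          have "d > 0" using that hx by (simp add: d_def)
          then obtain b where b: "b \<in> V" "op_norm ell2 (diag b - T) < d" using near by blast
          have "cmod (diag b x i - T x i) \<le> op_norm ell2 (diag b - T) * hnorm ell2 x"
            using op_norm_coord[OF bounded_ops_diff[OF diag_bounded_ops T(1)] x, of b i] b V by auto
          also have "\<dots> \<le> d * hnorm ell2 x" using b hx by (intro mult_right_mono) auto
          finally have 1: "cmod (diag b x i - T x i) \<le> d * hnorm ell2 x" .
          have "cmod (b i - a i) \<le> d" using ab[OF b(1), of i] b(2) by (simp add: norm_minus_commute)
          then have 2: "cmod ((b i - a i) * x i) \<le> d * hnorm ell2 x"
            unfolding norm_mult using ell2_coord_le[OF x, of i] \<open>d > 0\<close> by (intro mult_mono) auto
          have eq: "T x i - a i * x i = (b i - a i) * x i - (diag b x i - T x i)"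
            using x by (simp add: diag_def algebra_simps)
          have "cmod (T x i - a i * x i) \<le> cmod ((b i - a i) * x i) + cmod (diag b x i - T x i)"
            unfolding eq by (rule norm_triangle_ineq4)
          then have "cmod (T x i - a i * x i) \<le> d * (2 * hnorm ell2 x)" using 1 2 by simp
          also have "\<dots> \<le> d * (2 * (hnorm ell2 x + 1))" using \<open>d > 0\<close> by (intro mult_left_mono) auto
          also have "\<dots> = e" using hx by (simp add: d_def)
          finally show ?thesis by simp
        qed
        then have "cmod (T x i - a i * x i) \<le> 0" for i by (rule field_le_epsilon)
        then show ?thesis using x by (simp add: diag_def fun_eq_iff)
      qed
    qed
    ultimately show False using T by blast
  qed
  then show ?thesis
    unfolding op_topology_def closedin_metric using V diag_bounded_ops by blast
qed

lemma module_op_scale: "Modules.module (op_scale ell2)"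
  by unfold_locales (auto simp: op_scale_def fun_eq_iff algebra_simps)

lemma operator_space_diag:
  assumes V: "V \<subseteq> bounded_seqs"
    and closed: "\<And>a. (\<And>e. e > 0 \<Longrightarrow> \<exists>b\<in>V. \<forall>i. cmod (a i - b i) \<le> e) \<Longrightarrow> a \<in> V"
    and "0 \<in> V" and add: "\<And>a b. a \<in> V \<Longrightarrow> b \<in> V \<Longrightarrow> a + b \<in> V"
    and scale: "\<And>c a. a \<in> V \<Longrightarrow> (\<lambda>i. c * a i) \<in> V"
  shows "operator_space ell2 (diag ` V)"
  unfolding operator_space_def Modules.module.subspace_def[OF module_op_scale]
proof (intro conjI hilbert_space_ell2 closedin_diag V closed)
  show "diag ` V \<subseteq> bounded_ops ell2" using V diag_bounded_ops by blast
  show "0 \<in> diag ` V" using \<open>0 \<in> V\<close> diag_zero by (metis imageI)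
qed (auto simp: diag_add diag_scale intro!: imageI add scale)

text \<open>Approximating from outside is enough: each point of \<open>C\<close> is replaced, for
  every precision \<open>1/(n+1)\<close>, by a point of \<open>S\<close> that is this close to it,
  if there is one.\<close>

lemma separable_subspace_metric:
  assumes "Metric_space M d" "S \<subseteq> M" "countable C" "C \<subseteq> M"
    and dense: "\<And>x e. x \<in> S \<Longrightarrow> e > 0 \<Longrightarrow> \<exists>c\<in>C. d x c < e"
  shows "separable_space (subtopology (Metric_space.mtopology M d) S)"
proof -
  interpret Metric_space M d by fact
  define P where "P = (\<lambda>(c, n). c \<in> C \<and> (\<exists>x\<in>S. d x c < 1 / real (Suc n)))"
  define g where "g = (\<lambda>(c, n). SOME x. x \<in> S \<and> d x c < 1 / real (Suc n))"
  have g: "g (c, n) \<in> S \<and> d (g (c, n)) c < 1 / real (Suc n)" if "P (c, n)" for c n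
    unfolding g_def prod.case by (rule someI_ex) (use that in \<open>auto simp: P_def\<close>)
  define D where "D = g ` {p \<in> C \<times> UNIV. P p}"
  have "countable D" unfolding D_def using assms(3) by (intro countable_image) auto
  moreover have DS: "D \<subseteq> S" using g by (auto simp: D_def)
  moreover have "S \<subseteq> mtopology closure_of D"
  proof
    fix x assume x: "x \<in> S"
    show "x \<in> mtopology closure_of D"
      unfolding metric_closure_of
    proof (intro CollectI conjI allI impI)
      show "x \<in> M" using x assms(2) by blast
      fix r :: real assume "r > 0"
      then obtain n where n: "1 / real (Suc n) < r / 2" using reals_Archimedean[of "r/2"] by (auto simp: inverse_eq_divide)
      obtain c where c: "c \<in> C" "d x c < 1 / real (Suc n)" using dense[OF x, of "1 / real (Suc n)"] by auto
      have P: "P (c, n)" using c x by (auto simp: P_def)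
      have "d x (g (c, n)) \<le> d x c + d (g (c, n)) c"
        using triangle[of x c "g (c, n)"] g[OF P] c x assms commute by force
      also have "\<dots> < r" using c(2) g[OF P] n by linarith
      finally have "g (c, n) \<in> mball x r" using g[OF P] x assms(2) by (auto simp: in_mball)
      then show "\<exists>y\<in>D. y \<in> mball x r" using P c unfolding D_def by blast
    qed
  qed
  ultimately show ?thesis
    unfolding separable_space_def using assms(2)
    by (intro exI[of _ D]) (auto simp: closure_of_subtopology Int_absorb1)
qed

lemma separable_op_space_diag:
  assumes "operator_space ell2 (diag ` V)" "V \<subseteq> bounded_seqs" "countable C" "C \<subseteq> bounded_seqs"
    and dense: "\<And>a e. a \<in> V \<Longrightarrow> e > 0 \<Longrightarrow> \<exists>c\<in>C. \<forall>i. cmod (a i - c i) \<le> e"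
  shows "separable_op_space ell2 (diag ` V)"
  unfolding separable_op_space_def op_topology_def
proof (intro conjI assms(1) separable_subspace_metric[OF Metric_space_op, of _ "diag ` C"])
  show "diag ` V \<subseteq> bounded_ops ell2" "diag ` C \<subseteq> bounded_ops ell2"
    using assms diag_bounded_ops by auto
  show "countable (diag ` C)" using assms(3) by simp
  fix T and e :: real assume "T \<in> diag ` V" "e > 0"
  then obtain a where a: "a \<in> V" "T = diag a" by blast
  obtain c where c: "c \<in> C" "\<forall>i. cmod (a i - c i) \<le> e / 2" using dense[OF a(1), of "e/2"] \<open>e > 0\<close> by auto
  have "op_norm ell2 (diag (a - c)) \<le> e / 2" by (rule op_norm_diag_le) (use c in simp)
  then have "op_dist ell2 T (diag c) < e"
    using \<open>e > 0\<close> by (simp add: op_dist_def a diag_diff)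
  then show "\<exists>c\<in>diag ` C. op_dist ell2 T c < e" using c by blast
qed

section \<open>Matrices of diagonal operators\<close>

text \<open>The operator norm of the scalar matrix \<open>c\<close> on the
  \<open>n\<close>-dimensional Hilbert space is at most \<open>r\<close>.\<close>

definition scalar_mat_bound :: "nat \<Rightarrow> (nat \<Rightarrow> nat \<Rightarrow> complex) \<Rightarrow> real \<Rightarrow> bool" where
  "scalar_mat_bound n c r \<longleftrightarrow>
     (\<forall>v. L2_set (\<lambda>i. cmod (\<Sum>j<n. c i j * v j)) {..<n} \<le> r * L2_set (\<lambda>j. cmod (v j)) {..<n})"

lemma sum_apply: "(\<Sum>j\<in>S. f j) t = (\<Sum>j\<in>S. f j t)" for f :: "'a \<Rightarrow> 'b \<Rightarrow> 'c::comm_monoid_add"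
  by (induction S rule: infinite_finite_induct) auto

lemma ell2_sum: "(\<Sum>j\<in>S. f j) \<in> hcarrier ell2" if "\<And>j. j \<in> S \<Longrightarrow> f j \<in> hcarrier ell2"
  using that by (induction S rule: infinite_finite_induct) (auto simp: ell2_add)

lemma L2_set_upper: "cmod (v j) \<le> L2_set (\<lambda>j. cmod (v j)) {..<n}" if "j < n" for n :: nat
  using that by (intro member_le_L2_set) auto

text \<open>The factor \<open>n\<^sup>2\<close> is crude but harmless: the maps constructed below
  are made accurate enough, depending on \<open>n\<close>, to absorb it.\<close>

lemma scalar_mat_bound_entries:
  assumes "\<And>i j. i < n \<Longrightarrow> j < n \<Longrightarrow> cmod (c i j) \<le> e"
  shows "scalar_mat_bound n c ((real n)\<^sup>2 * e)"
  unfolding scalar_mat_bound_def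
proof
  fix v :: "nat \<Rightarrow> complex"
  let ?s = "L2_set (\<lambda>j. cmod (v j)) {..<n}"
  have "L2_set (\<lambda>i. cmod (\<Sum>j<n. c i j * v j)) {..<n} \<le> (\<Sum>i<n. cmod (\<Sum>j<n. c i j * v j))"
    by (rule L2_set_le_sum) simp
  also have "\<dots> \<le> (\<Sum>i<n. \<Sum>j<n. e * ?s)"
  proof (intro sum_mono order_trans[OF norm_sum])
    fix i j assume ij: "i \<in> {..<n}" "j \<in> {..<n}"
    then have "0 \<le> e" using assms[of i j] norm_ge_zero[of "c i j"] by (simp del: norm_ge_zero)
    then show "cmod (c i j * v j) \<le> e * ?s"
      unfolding norm_mult using ij by (intro mult_mono assms L2_set_upper) auto
  qed
  also have "\<dots> = (real n)\<^sup>2 * e * ?s" by (simp add: power2_eq_square)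
  finally show "L2_set (\<lambda>i. cmod (\<Sum>j<n. c i j * v j)) {..<n} \<le> (real n)\<^sup>2 * e * ?s" .
qed

lemma scalar_mat_bound_add:
  assumes "scalar_mat_bound n a r" "scalar_mat_bound n b s"
  shows "scalar_mat_bound n (\<lambda>i j. a i j + b i j) (r + s)"
  unfolding scalar_mat_bound_def
proof
  fix v :: "nat \<Rightarrow> complex"
  have "L2_set (\<lambda>i. cmod (\<Sum>j<n. (a i j + b i j) * v j)) {..<n}
      \<le> L2_set (\<lambda>i. cmod (\<Sum>j<n. a i j * v j) + cmod (\<Sum>j<n. b i j * v j)) {..<n}"
    by (intro L2_set_mono) (auto simp: distrib_right sum.distrib norm_triangle_ineq)
  also have "\<dots> \<le> L2_set (\<lambda>i. cmod (\<Sum>j<n. a i j * v j)) {..<n} + L2_set (\<lambda>i. cmod (\<Sum>j<n. b i j * v j)) {..<n}"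
    by (rule L2_set_triangle_ineq)
  also have "\<dots> \<le> (r + s) * L2_set (\<lambda>j. cmod (v j)) {..<n}"
    using assms unfolding scalar_mat_bound_def by (simp add: add_mono distrib_right)
  finally show "L2_set (\<lambda>i. cmod (\<Sum>j<n. (a i j + b i j) * v j)) {..<n} \<le> (r + s) * L2_set (\<lambda>j. cmod (v j)) {..<n}" .
qed

lemma scalar_mat_bound_entry_le:
  assumes "scalar_mat_bound n c r" "i < n" "j < n"
  shows "cmod (c i j) \<le> r"
proof -
  define v where "v = (\<lambda>k. if k = j then 1 else 0 :: complex)"
  have "(\<Sum>k<n. c i k * v k) = c i j" for i
    using assms(3) by (simp add: v_def if_distrib[of "(*) _"] cong: if_cong)
  moreover have "L2_set (\<lambda>j. cmod (v j)) {..<n} = 1"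
  proof -
    have "(\<Sum>k<n. (cmod (v k))\<^sup>2) = (\<Sum>k<n. if k = j then 1 else 0)" by (intro sum.cong) (auto simp: v_def)
    then show ?thesis using assms(3) by (simp add: L2_set_def)
  qed
  ultimately have "L2_set (\<lambda>i. cmod (c i j)) {..<n} \<le> r"
    using assms(1)[unfolded scalar_mat_bound_def, rule_format, of v] by simp
  with L2_set_upper[OF assms(2), of "\<lambda>i. c i j"] show ?thesis by simp
qed

lemma scalar_mat_bound_mono: "scalar_mat_bound n c s" if "scalar_mat_bound n c r" "r \<le> s"
  using that unfolding scalar_mat_bound_def
  by (meson mult_right_mono L2_set_nonneg order_trans)

text \<open>A matrix of diagonal operators acts at each position of the diagonal separately, so the
  scalar bounds at the positions can be squared and added up.\<close>

lemma diag_matrix_apply_bound: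
  assumes bd: "\<And>t. scalar_mat_bound n (\<lambda>i j. a i j t) r" and "0 \<le> r"
    and x: "\<And>j. j < n \<Longrightarrow> x j \<in> hcarrier ell2"
    and a: "\<And>i j. i < n \<Longrightarrow> j < n \<Longrightarrow> a i j \<in> bounded_seqs"
  shows "L2_set (\<lambda>i. hnorm ell2 (\<Sum>j<n. diag (a i j) (x j))) {..<n} \<le> r * L2_set (\<lambda>j. hnorm ell2 (x j)) {..<n}"
proof -
  define y where "y = (\<lambda>i. \<Sum>j<n. diag (a i j) (x j))"
  have yt: "y i t = (\<Sum>j<n. a i j t * x j t)" for i t
    unfolding y_def sum_apply by (intro sum.cong refl) (simp add: diag_def x)
  have yc: "y i \<in> hcarrier ell2" if "i < n" for i
    unfolding y_def using that a diag_bounded_ops bounded_ops_carrier by (intro ell2_sum) auto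
  have sx: "summable (\<lambda>t. (cmod (x j t))\<^sup>2)" if "j < n" for j using x[OF that] by (simp add: ell2_carrier)
  have sy: "summable (\<lambda>t. (cmod (y i t))\<^sup>2)" if "i < n" for i using yc[OF that] by (simp add: ell2_carrier)
  have pt: "(\<Sum>i<n. (cmod (y i t))\<^sup>2) \<le> r\<^sup>2 * (\<Sum>j<n. (cmod (x j t))\<^sup>2)" for t
  proof -
    have "L2_set (\<lambda>i. cmod (y i t)) {..<n} \<le> r * L2_set (\<lambda>j. cmod (x j t)) {..<n}"
      unfolding yt using bd[of t] by (simp add: scalar_mat_bound_def)
    then have "(L2_set (\<lambda>i. cmod (y i t)) {..<n})\<^sup>2 \<le> (r * L2_set (\<lambda>j. cmod (x j t)) {..<n})\<^sup>2"
      by (intro power_mono) auto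
    then show ?thesis by (simp add: L2_set_def power_mult_distrib sum_nonneg)
  qed
  have "(\<Sum>i<n. (hnorm ell2 (y i))\<^sup>2) = (\<Sum>i<n. \<Sum>t. (cmod (y i t))\<^sup>2)"
    by (intro sum.cong refl) (simp add: hnorm_ell2_sq yc)
  also have "\<dots> = (\<Sum>t. \<Sum>i<n. (cmod (y i t))\<^sup>2)"
    by (rule suminf_sum[symmetric]) (simp add: sy)
  also have "\<dots> \<le> (\<Sum>t. r\<^sup>2 * (\<Sum>j<n. (cmod (x j t))\<^sup>2))"
    using sx sy by (intro suminf_le pt summable_mult summable_sum) auto
  also have "\<dots> = r\<^sup>2 * (\<Sum>j<n. \<Sum>t. (cmod (x j t))\<^sup>2)"
  proof -
    have "(\<Sum>t. \<Sum>j<n. (cmod (x j t))\<^sup>2) = (\<Sum>j<n. \<Sum>t. (cmod (x j t))\<^sup>2)"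
      by (rule suminf_sum) (simp add: sx)
    then show ?thesis using sx by (subst suminf_mult) (auto intro!: summable_sum)
  qed
  also have "\<dots> = r\<^sup>2 * (\<Sum>j<n. (hnorm ell2 (x j))\<^sup>2)"
    by (intro arg_cong2[where f = "(*)"] sum.cong refl) (simp add: hnorm_ell2_sq x)
  finally have "sqrt (\<Sum>i<n. (hnorm ell2 (y i))\<^sup>2) \<le> sqrt (r\<^sup>2 * (\<Sum>j<n. (hnorm ell2 (x j))\<^sup>2))"
    by (rule real_sqrt_le_mono)
  then show ?thesis using \<open>0 \<le> r\<close> by (simp add: L2_set_def real_sqrt_mult y_def)
qed

locale diag_matrix =
  fixes n :: nat and A :: "((nat \<Rightarrow> complex) \<Rightarrow> nat \<Rightarrow> complex) mat" and a :: "nat \<Rightarrow> nat \<Rightarrow> nat \<Rightarrow> complex"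
  assumes carrier: "A \<in> carrier_mat n n"
    and entry: "\<And>i j. i < n \<Longrightarrow> j < n \<Longrightarrow> A $$ (i, j) = diag (a i j)"
    and bounded: "\<And>i j. i < n \<Longrightarrow> j < n \<Longrightarrow> a i j \<in> bounded_seqs"
begin

lemma mat_op_norm_eq:
  "mat_op_norm ell2 A =
     (SUP \<xi>\<in>hsum_ball ell2 n. L2_set (\<lambda>i. hnorm ell2 (\<Sum>j<n. diag (a i j) (\<xi> $ j))) {..<n})"
proof -
  have "dim_col A = n" "dim_row A = n" using carrier by auto
  then show ?thesis
    unfolding mat_op_norm_def L2_set_def
    by (intro SUP_cong arg_cong[where f = sqrt] sum.cong arg_cong[where f = "\<lambda>x. (hnorm ell2 x)\<^sup>2"])
      (auto simp: entry)
qed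

lemma value_le:
  assumes "\<And>t. scalar_mat_bound n (\<lambda>i j. a i j t) r" "0 \<le> r" "\<xi> \<in> hsum_ball ell2 n"
  shows "L2_set (\<lambda>i. hnorm ell2 (\<Sum>j<n. diag (a i j) (\<xi> $ j))) {..<n} \<le> r"
proof -
  have "L2_set (\<lambda>i. hnorm ell2 (\<Sum>j<n. diag (a i j) (\<xi> $ j))) {..<n}
      \<le> r * L2_set (\<lambda>j. hnorm ell2 (\<xi> $ j)) {..<n}"
    using assms bounded by (intro diag_matrix_apply_bound) (auto simp: hsum_ball_def)
  also have "\<dots> \<le> r * 1"
    using assms by (intro mult_left_mono) (auto simp: hsum_ball_def L2_set_def)
  finally show ?thesis by simp
qed

lemma mat_op_norm_le:
  assumes "\<And>t. scalar_mat_bound n (\<lambda>i j. a i j t) r" "0 \<le> r"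
  shows "mat_op_norm ell2 A \<le> r"
  unfolding mat_op_norm_eq
proof (rule cSUP_least)
  have "0\<^sub>v n \<in> hsum_ball ell2 n" by (auto simp: hsum_ball_def zero_vec_def)
  then show "hsum_ball ell2 n \<noteq> {}" by blast
qed (rule value_le[OF assms])

lemma bdd_above_values:
  "bdd_above ((\<lambda>\<xi>. L2_set (\<lambda>i. hnorm ell2 (\<Sum>j<n. diag (a i j) (\<xi> $ j))) {..<n}) ` hsum_ball ell2 n)"
proof -
  have "\<forall>i j. \<exists>b. i < n \<longrightarrow> j < n \<longrightarrow> (\<forall>t. cmod (a i j t) \<le> b)" using bounded unfolding bounded_seqs_def by blast
  then obtain b where b: "\<And>i j t. i < n \<Longrightarrow> j < n \<Longrightarrow> cmod (a i j t) \<le> b i j" by metis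
  have b0: "0 \<le> b i j" if "i < n" "j < n" for i j
    using norm_ge_zero b[OF that] by (rule order_trans)
  define e where "e = (\<Sum>i<n. \<Sum>j<n. b i j)"
  have "cmod (a i j t) \<le> e" if "i < n" "j < n" for i j t
  proof -
    have "b i j \<le> (\<Sum>j<n. b i j)" using that b0 by (intro member_le_sum) auto
    also have "\<dots> \<le> e" unfolding e_def using that b0
      by (intro member_le_sum[of i "{..<n}" "\<lambda>i. \<Sum>j<n. b i j"]) (auto intro!: sum_nonneg)
    finally show ?thesis using b[OF that, of t] by linarith
  qed
  then have s: "scalar_mat_bound n (\<lambda>i j. a i j t) ((real n)\<^sup>2 * e)" for t
    by (intro scalar_mat_bound_entries)
  have "0 \<le> (real n)\<^sup>2 * e" unfolding e_def using b0 by (intro mult_nonneg_nonneg sum_nonneg) auto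
  then show ?thesis using value_le[OF s] by (intro bdd_aboveI2)
qed

text \<open>The converse of the preceding bound: test vectors supported at the single position
  \<open>t\<close> recover the scalar matrix at \<open>t\<close>.\<close>

lemma scalar_mat_bound_mat_op_norm: "scalar_mat_bound n (\<lambda>i j. a i j t) (mat_op_norm ell2 A)"
  unfolding scalar_mat_bound_def
proof
  fix v :: "nat \<Rightarrow> complex"
  define s where "s = L2_set (\<lambda>j. cmod (v j)) {..<n}"
  show "L2_set (\<lambda>i. cmod (\<Sum>j<n. a i j t * v j)) {..<n} \<le> mat_op_norm ell2 A * s"
  proof (cases "s = 0")
    case True
    then have "v j = 0" if "j < n" for j using L2_set_upper[OF that, of v] by (simp add: s_def)
    then show ?thesis using True by (simp add: L2_set_def)
  next
    case False
    then have s: "s > 0" by (simp add: s_def less_le)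
    \<comment> \<open>Spread a normalised scalar vector over the components, all at position \<open>t\<close>.\<close>
    define w where "w = (\<lambda>j. v j / s)"
    define \<xi> where "\<xi> = vec n (\<lambda>j i. w j * unit_seq t i)"
    have \<xi>j: "\<xi> $ j \<in> hcarrier ell2" "hnorm ell2 (\<xi> $ j) = cmod (w j)" if "j < n" for j
      using that ell2_scale[of "unit_seq t" "w j"] by (simp_all add: \<xi>_def)
    have "L2_set (\<lambda>j. hnorm ell2 (\<xi> $ j)) {..<n} = L2_set (\<lambda>j. (1/s) * cmod (v j)) {..<n}"
      using s by (intro L2_set_cong) (auto simp: \<xi>j w_def norm_divide)
    also have "\<dots> = 1/s * s"
      unfolding s_def[symmetric] using s by (subst L2_set_right_distrib[symmetric]) (simp_all add: s_def)
    finally have "L2_set (\<lambda>j. hnorm ell2 (\<xi> $ j)) {..<n} = 1" using s by simp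
    then have ball: "\<xi> \<in> hsum_ball ell2 n"
      using \<xi>j by (auto simp: hsum_ball_def L2_set_def \<xi>_def)
    have val: "hnorm ell2 (\<Sum>j<n. diag (a i j) (\<xi> $ j)) = cmod (\<Sum>j<n. a i j t * v j) / s" for i
    proof -
      have "(\<Sum>j<n. diag (a i j) (\<xi> $ j)) = (\<lambda>k. (\<Sum>j<n. a i j t * w j) * unit_seq t k)"
      proof (rule ext)
        fix k
        have "(\<Sum>j<n. diag (a i j) (\<xi> $ j)) k = (\<Sum>j<n. a i j k * (w j * unit_seq t k))"
          unfolding sum_apply using \<xi>j(1) by (intro sum.cong refl) (simp add: diag_def \<xi>_def)
        also have "\<dots> = (\<Sum>j<n. a i j t * w j) * unit_seq t k"
          by (simp add: unit_seq_def sum_distrib_right)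
        finally show "(\<Sum>j<n. diag (a i j) (\<xi> $ j)) k = (\<Sum>j<n. a i j t * w j) * unit_seq t k" .
      qed
      then have "hnorm ell2 (\<Sum>j<n. diag (a i j) (\<xi> $ j)) = cmod (\<Sum>j<n. a i j t * w j)"
        by (simp add: ell2_scale)
      also have "(\<Sum>j<n. a i j t * w j) = (\<Sum>j<n. a i j t * v j) / s"
        by (simp add: w_def sum_divide_distrib)
      finally show ?thesis using s by (simp add: norm_divide)
    qed
    have "L2_set (\<lambda>i. hnorm ell2 (\<Sum>j<n. diag (a i j) (\<xi> $ j))) {..<n} \<le> mat_op_norm ell2 A"
      unfolding mat_op_norm_eq using ball bdd_above_values by (rule cSUP_upper)
    also have "L2_set (\<lambda>i. hnorm ell2 (\<Sum>j<n. diag (a i j) (\<xi> $ j))) {..<n}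
        = L2_set (\<lambda>i. (1/s) * cmod (\<Sum>j<n. a i j t * v j)) {..<n}"
      by (simp add: val)
    also have "\<dots> = 1/s * L2_set (\<lambda>i. cmod (\<Sum>j<n. a i j t * v j)) {..<n}"
      using s by (subst L2_set_right_distrib[symmetric]) simp_all
    finally show ?thesis using s by (simp add: field_simps)
  qed
qed

lemma mat_op_norm_nonneg: "0 \<le> mat_op_norm ell2 A"
proof -
  have "0\<^sub>v n \<in> hsum_ball ell2 n" by (auto simp: hsum_ball_def zero_vec_def)
  then have "L2_set (\<lambda>i. hnorm ell2 (\<Sum>j<n. diag (a i j) (0\<^sub>v n $ j))) {..<n} \<le> mat_op_norm ell2 A"
    unfolding mat_op_norm_eq using bdd_above_values by (rule cSUP_upper)
  with L2_set_nonneg show ?thesis by (rule order_trans)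
qed

end

lemma bounded_seqs_diff: "a - b \<in> bounded_seqs" if ab: "a \<in> bounded_seqs" "b \<in> bounded_seqs"
proof -
  obtain r s where rs: "\<forall>i. cmod (a i) \<le> r" "\<forall>i. cmod (b i) \<le> s" using ab by (auto simp: bounded_seqs_def)
  have "cmod (a i - b i) \<le> r + s" for i
    using norm_triangle_ineq4[of "a i" "b i"] rs by (meson add_mono order_trans)
  then show ?thesis by (auto simp: bounded_seqs_def)
qed

lemma diag_matrix_diff: "diag_matrix n (A - B) (\<lambda>i j. a i j - b i j)"
  if A: "diag_matrix n A a" and B: "diag_matrix n B b"
proof
  interpret A: diag_matrix n A a by fact
  interpret B: diag_matrix n B b by fact
  show "A - B \<in> carrier_mat n n" using B.carrier by (rule minus_carrier_mat)
  show "(A - B) $$ (i, j) = diag (a i j - b i j)" "a i j - b i j \<in> bounded_seqs" if "i < n" "j < n" for i j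
    using that A.carrier B.carrier A.entry B.entry A.bounded B.bounded
    by (auto simp: diag_diff bounded_seqs_diff)
qed

lemma matrices_over_diag:
  assumes "A \<in> matrices_over n (diag ` V)" "V \<subseteq> bounded_seqs"
  obtains a where "diag_matrix n A a" "\<And>i j. i < n \<Longrightarrow> j < n \<Longrightarrow> a i j \<in> V"
proof -
  have A: "A \<in> carrier_mat n n" "elements_mat A \<subseteq> diag ` V" using assms by (auto simp: matrices_over_def)
  have "A $$ (i, j) \<in> diag ` V" if "i < n" "j < n" for i j
    using A that unfolding elements_mat_def by fastforce
  then have "\<forall>i j. \<exists>v. i < n \<longrightarrow> j < n \<longrightarrow> v \<in> V \<and> A $$ (i, j) = diag v" by blast
  then obtain a where "\<And>i j. i < n \<Longrightarrow> j < n \<Longrightarrow> a i j \<in> V \<and> A $$ (i, j) = diag (a i j)" by metis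
  then show thesis using A(1) assms(2) by (intro that[of a]) (auto simp: diag_matrix_def)
qed

lemma matrices_overI:
  assumes "A \<in> carrier_mat n n" "\<And>i j. i < n \<Longrightarrow> j < n \<Longrightarrow> A $$ (i, j) \<in> X"
  shows "A \<in> matrices_over n X"
  using assms unfolding matrices_over_def elements_mat_def by auto

text \<open>A map of positions cannot increase the norm, because the norm is a supremum over
  positions.\<close>

lemma mat_op_norm_reindex_le:
  assumes A: "diag_matrix n A a" and B: "diag_matrix n B b"
    and near: "\<And>i j t. i < n \<Longrightarrow> j < n \<Longrightarrow> cmod (b i j t - a i j (r t)) \<le> e"
    and "0 \<le> e"
  shows "mat_op_norm ell2 B \<le> mat_op_norm ell2 A + (real n)\<^sup>2 * e"
proof -
  interpret A: diag_matrix n A a by fact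
  interpret B: diag_matrix n B b by fact
  have "scalar_mat_bound n (\<lambda>i j. a i j (r t) + (b i j t - a i j (r t))) (mat_op_norm ell2 A + (real n)\<^sup>2 * e)" for t
    by (intro scalar_mat_bound_add A.scalar_mat_bound_mat_op_norm scalar_mat_bound_entries near)
  then show ?thesis
    using A.mat_op_norm_nonneg \<open>0 \<le> e\<close> by (intro B.mat_op_norm_le) simp_all
qed

text \<open>A map between spaces of diagonals that is, up to \<open>1/n\<^sup>2\<close> on the ball
  of radius \<open>n\<close>, a composition with a map of positions changes distances in the
  \<open>n\<close>-th amplification by at most \<open>2\<close>. Surjectivity of the map of
  positions gives the lower estimate: the inequality can then be read backwards along a section.\<close>

lemma equi_coarse_embedding_diag:
  fixes h :: "nat \<Rightarrow> (nat \<Rightarrow> complex) \<Rightarrow> nat \<Rightarrow> complex" and r :: "nat \<Rightarrow> nat \<Rightarrow> nat"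
  assumes V: "V \<subseteq> bounded_seqs" and W: "W \<subseteq> bounded_seqs"
    and F: "\<And>n a. n \<ge> 1 \<Longrightarrow> a \<in> V \<Longrightarrow> F n (diag a) = diag (h n a)"
    and h: "\<And>n a. n \<ge> 1 \<Longrightarrow> a \<in> V \<Longrightarrow> h n a \<in> W"
    and surj: "\<And>n. surj (r n)"
    and near: "\<And>n a t. n \<ge> 1 \<Longrightarrow> a \<in> V \<Longrightarrow> (\<forall>i. cmod (a i) \<le> real n) \<Longrightarrow> cmod (h n a t - a (r n t)) \<le> 1 / (real n)\<^sup>2"
  shows "equi_coarse_embedding {1..}
          (\<lambda>n. mat_ball ell2 (diag ` V) n (real n)) (\<lambda>n. mat_op_dist ell2)
          (\<lambda>n. matrices_over n (diag ` W)) (\<lambda>n. mat_op_dist ell2)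
          (\<lambda>n. map_mat (F n))"
proof -
  have dm: "diag_matrix n (map_mat (F n) A) (\<lambda>i j. h n (a i j))"
    if "n \<ge> 1" "diag_matrix n A a" "\<And>i j. i < n \<Longrightarrow> j < n \<Longrightarrow> a i j \<in> V" for n A a
    using that W h by (auto simp: diag_matrix_def F)
  have ball: "\<exists>a. diag_matrix n A a \<and> (\<forall>i<n. \<forall>j<n. a i j \<in> V \<and> (\<forall>t. cmod (a i j t) \<le> real n))"
    if A: "A \<in> mat_ball ell2 (diag ` V) n (real n)" for n A
  proof -
    obtain a where a: "diag_matrix n A a" "\<And>i j. i < n \<Longrightarrow> j < n \<Longrightarrow> a i j \<in> V"
      using A V matrices_over_diag[of A n V] by (auto simp: mat_ball_def)
    interpret diag_matrix n A a by fact
    have "scalar_mat_bound n (\<lambda>i j. a i j t) (real n)" for t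
      using scalar_mat_bound_mat_op_norm A by (rule_tac scalar_mat_bound_mono) (auto simp: mat_ball_def)
    then have "cmod (a i j t) \<le> real n" if "i < n" "j < n" for i j t
      using scalar_mat_bound_entry_le that by blast
    with a show ?thesis by blast
  qed
  have dist: "mat_op_dist ell2 (map_mat (F n) A) (map_mat (F n) B) \<le> mat_op_dist ell2 A B + 2 \<and>
      mat_op_dist ell2 A B \<le> mat_op_dist ell2 (map_mat (F n) A) (map_mat (F n) B) + 2"
    if n: "n \<ge> 1" and A: "A \<in> mat_ball ell2 (diag ` V) n (real n)" and B: "B \<in> mat_ball ell2 (diag ` V) n (real n)"
    for n A B
  proof -
    obtain a where a: "diag_matrix n A a" "\<forall>i<n. \<forall>j<n. a i j \<in> V \<and> (\<forall>t. cmod (a i j t) \<le> real n)"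
      using ball[OF A] by blast
    obtain b where b: "diag_matrix n B b" "\<forall>i<n. \<forall>j<n. b i j \<in> V \<and> (\<forall>t. cmod (b i j t) \<le> real n)"
      using ball[OF B] by blast
    have FA: "diag_matrix n (map_mat (F n) A) (\<lambda>i j. h n (a i j))" using dm[OF n a(1)] a(2) by blast
    have FB: "diag_matrix n (map_mat (F n) B) (\<lambda>i j. h n (b i j))" using dm[OF n b(1)] b(2) by blast
    note D = diag_matrix_diff[OF a(1) b(1)] and FD = diag_matrix_diff[OF FA FB]
    have nr: "cmod ((h n (a i j) - h n (b i j)) t - (a i j - b i j) (r n t)) \<le> 2 / (real n)\<^sup>2"
      if "i < n" "j < n" for i j t
    proof -
      have "(h n (a i j) - h n (b i j)) t - (a i j - b i j) (r n t)
        = (h n (a i j) t - a i j (r n t)) - (h n (b i j) t - b i j (r n t))" by simp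
      then have "cmod ((h n (a i j) - h n (b i j)) t - (a i j - b i j) (r n t))
        \<le> cmod (h n (a i j) t - a i j (r n t)) + cmod (h n (b i j) t - b i j (r n t))"
        by (metis norm_triangle_ineq4)
      also have "\<dots> \<le> 1 / (real n)\<^sup>2 + 1 / (real n)\<^sup>2"
        using a(2) b(2) that by (intro add_mono near n) auto
      finally show ?thesis by simp
    qed
    have nr': "cmod ((a i j - b i j) t - (h n (a i j) - h n (b i j)) (inv_into UNIV (r n) t)) \<le> 2 / (real n)\<^sup>2"
      if "i < n" "j < n" for i j t
      using nr[OF that, of "inv_into UNIV (r n) t"] surj_f_inv_f[OF surj, of n t] by (simp add: norm_minus_commute)
    have eq: "(real n)\<^sup>2 * (2 / (real n)\<^sup>2) = 2" using n by simp
    show ?thesis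
      unfolding mat_op_dist_def
      using mat_op_norm_reindex_le[OF D FD nr] mat_op_norm_reindex_le[OF FD D nr'] eq by simp
  qed
  show ?thesis
    unfolding equi_coarse_embedding_def
  proof (intro conjI ballI allI impI)
    fix n :: nat assume n: "n \<in> {1..}"
    show "map_mat (F n) \<in> mat_ball ell2 (diag ` V) n (real n) \<rightarrow> matrices_over n (diag ` W)"
    proof
      fix A assume "A \<in> mat_ball ell2 (diag ` V) n (real n)"
      then obtain a where a: "diag_matrix n A a" "\<forall>i<n. \<forall>j<n. a i j \<in> V" using ball by blast
      with dm[of n A a] n have FA: "diag_matrix n (map_mat (F n) A) (\<lambda>i j. h n (a i j))" by auto
      show "map_mat (F n) A \<in> matrices_over n (diag ` W)"
        using FA n h a(2) by (intro matrices_overI) (auto simp: diag_matrix_def)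
    qed
  next
    fix t :: real assume "t \<ge> 0"
    have "equi_expansion {1..} (\<lambda>n. mat_ball ell2 (diag ` V) n (real n)) (\<lambda>n. mat_op_dist ell2)
         (\<lambda>n. mat_op_dist ell2) (\<lambda>n. map_mat (F n)) t \<le> ennreal (t + 2)"
      unfolding equi_expansion_def using dist by (force intro!: SUP_least ennreal_leI)
    also have "\<dots> < \<infinity>" by simp
    finally show "equi_expansion {1..} (\<lambda>n. mat_ball ell2 (diag ` V) n (real n)) (\<lambda>n. mat_op_dist ell2)
         (\<lambda>n. mat_op_dist ell2) (\<lambda>n. map_mat (F n)) t < \<infinity>" .
  next
    let ?c = "equi_compression {1..} (\<lambda>n. mat_ball ell2 (diag ` V) n (real n)) (\<lambda>n. mat_op_dist ell2)
         (\<lambda>n. mat_op_dist ell2) (\<lambda>n. map_mat (F n))"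
    have c: "ennreal (t - 2) \<le> ?c t" for t
      unfolding equi_compression_def using dist by (force intro!: INF_greatest ennreal_leI)
    show "(?c \<longlongrightarrow> \<infinity>) at_top"
    proof (rule order_tendstoI)
      fix x :: ennreal assume "x < \<infinity>"
      then obtain s where s: "x = ennreal s" "0 \<le> s" by (cases x) auto
      have "x < ?c t" if "t \<ge> s + 3" for t
      proof -
        have "x < ennreal (t - 2)" using s that by (simp add: ennreal_less_iff)
        then show ?thesis using c by (rule less_le_trans)
      qed
      then show "eventually (\<lambda>t. x < ?c t) at_top" by (auto simp: eventually_at_top_linorder)
    qed simp
  qed
qed

section \<open>Signs, tails, and a lifting of null sequences through a quotient map\<close>

text \<open>For complex numbers \<open>s\<close> and \<open>a\<close>, the average of \<open>|s +
  a|\<close> and \<open>|s - a|\<close> is at least \<open>max |s| |a|\<close>. Fixing the signs one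
  at a time, each never worse than the average, the value selected at \<open>t\<close> survives all
  later choices.\<close>

lemma exists_signs_sum_ge_selection:
  fixes a :: "nat \<Rightarrow> 't \<Rightarrow> complex"
  assumes "finite T"
  shows "\<exists>c :: nat \<Rightarrow> complex. (\<forall>i. c i = 1 \<or> c i = -1) \<and>
           (\<Sum>t\<in>T. if i t < n then cmod (a (i t) t) else cmod (s t))
             \<le> (\<Sum>t\<in>T. cmod (s t + (\<Sum>i<n. c i * a i t)))"
proof (induction n arbitrary: s)
  case 0
  show ?case by (rule exI[of _ "\<lambda>_. 1"]) simp
next
  case (Suc n)
  define v where "v = (\<lambda>u. \<Sum>t\<in>T. if i t < n then cmod (a (i t) t) else cmod (s t + u * a n t))"
  let ?m = "\<Sum>t\<in>T. if i t < Suc n then cmod (a (i t) t) else cmod (s t)"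
  have "2 * ?m \<le> v 1 + v (-1)"
    unfolding v_def sum.distrib[symmetric] sum_distrib_left
  proof (rule sum_mono)
    fix t assume "t \<in> T"
    have 1: "2 * cmod (s t) \<le> cmod (s t + a n t) + cmod (s t - a n t)"
      using norm_triangle_ineq[of "s t + a n t" "s t - a n t"] by (simp flip: mult_2 add: norm_mult)
    have 2: "2 * cmod (a n t) \<le> cmod (s t + a n t) + cmod (s t - a n t)"
      using norm_triangle_ineq4[of "s t + a n t" "s t - a n t"] by (simp flip: mult_2 add: norm_mult)
    show "2 * (if i t < Suc n then cmod (a (i t) t) else cmod (s t))
        \<le> (if i t < n then cmod (a (i t) t) else cmod (s t + 1 * a n t)) +
          (if i t < n then cmod (a (i t) t) else cmod (s t + - 1 * a n t))"
      using 1 2 by (auto simp: less_Suc_eq)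
  qed
  then have "?m \<le> v 1 \<or> ?m \<le> v (-1)" by linarith
  then obtain u :: complex where u: "u = 1 \<or> u = -1" "?m \<le> v u" by blast
  obtain c where c: "\<forall>i. c i = 1 \<or> c i = -1"
    "v u \<le> (\<Sum>t\<in>T. cmod ((s t + u * a n t) + (\<Sum>i<n. c i * a i t)))"
    using Suc.IH[of "\<lambda>t. s t + u * a n t"] unfolding v_def by blast
  show ?case
  proof (intro exI[of _ "c(n := u)"] conjI)
    show "\<forall>i. (c(n := u)) i = 1 \<or> (c(n := u)) i = -1" using c u by auto
    have "(\<Sum>i<n. (c(n := u)) i * a i t) = (\<Sum>i<n. c i * a i t)" for t
      by (intro sum.cong) auto
    then show "?m \<le> (\<Sum>t\<in>T. cmod (s t + (\<Sum>i<Suc n. (c(n := u)) i * a i t)))"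
      using u(2) c(2) by (simp add: algebra_simps)
  qed
qed

text \<open>This is the Cauchy criterion for the supremum over the index \<open>i\<close>: a finite
  set on which a selection comes within \<open>e\<close> of the supremum of all such sums leaves at
  most \<open>e\<close> for the rest, for every selection.\<close>

lemma selection_sums_uniform_tail:
  fixes a :: "'p \<Rightarrow> 't \<Rightarrow> complex"
  assumes bd: "\<And>F i. finite F \<Longrightarrow> (\<Sum>t\<in>F. cmod (a (i t) t)) \<le> C" and "e > 0"
  shows "\<exists>F0. finite F0 \<and> (\<forall>F i. finite F \<longrightarrow> F \<inter> F0 = {} \<longrightarrow> (\<Sum>t\<in>F. cmod (a (i t) t)) \<le> e)"
proof -
  define S where "S = {(\<Sum>t\<in>F. cmod (a (i t) t)) |F i. finite F}"
  have ne: "S \<noteq> {}" and bdd: "bdd_above S" unfolding S_def using bd by (auto intro!: bdd_aboveI)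
  have "Sup S - e < Sup S" using \<open>e > 0\<close> by simp
  then obtain y where y: "y \<in> S" "Sup S - e < y"
    using less_cSup_iff[OF ne bdd] by blast
  obtain F0 i0 where F0: "finite F0" "y = (\<Sum>t\<in>F0. cmod (a (i0 t) t))" using y(1) by (auto simp: S_def)
  have "(\<Sum>t\<in>F. cmod (a (i t) t)) \<le> e" if F: "finite F" "F \<inter> F0 = {}" for F i
  proof -
    let ?i = "\<lambda>t. if t \<in> F0 then i0 t else i t"
    have "(\<Sum>t\<in>F \<union> F0. cmod (a (?i t) t)) \<le> Sup S"
      using F F0 by (intro cSup_upper bdd) (auto simp: S_def)
    also have "(\<Sum>t\<in>F \<union> F0. cmod (a (?i t) t)) = (\<Sum>t\<in>F. cmod (a (?i t) t)) + (\<Sum>t\<in>F0. cmod (a (?i t) t))"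
      using F F0 by (intro sum.union_disjoint) auto
    also have "(\<Sum>t\<in>F. cmod (a (?i t) t)) = (\<Sum>t\<in>F. cmod (a (i t) t))"
      using F by (intro sum.cong) auto
    also have "(\<Sum>t\<in>F0. cmod (a (?i t) t)) = y" unfolding F0 by (intro sum.cong) auto
    finally show ?thesis using y(2) by linarith
  qed
  then show ?thesis using F0(1) by blast
qed

lemma has_sum_approx:
  fixes f :: "'a \<Rightarrow> complex"
  assumes "\<And>e. e > 0 \<Longrightarrow> \<exists>g c. (g has_sum c) A \<and> cmod (c - l) \<le> e \<and>
      (\<forall>F. finite F \<longrightarrow> F \<subseteq> A \<longrightarrow> cmod (sum f F - sum g F) \<le> e)"
  shows "(f has_sum l) A"
  unfolding has_sum_def
proof (rule tendstoI)
  fix e :: real assume "e > 0"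
  then obtain g c where g: "(g has_sum c) A" "cmod (c - l) \<le> e / 4"
      "\<And>F. finite F \<Longrightarrow> F \<subseteq> A \<Longrightarrow> cmod (sum f F - sum g F) \<le> e / 4"
    using assms[of "e/4"] by auto
  have "eventually (\<lambda>F. dist (sum g F) c < e / 4) (finite_subsets_at_top A)"
    using g(1) \<open>e > 0\<close> unfolding has_sum_def by (intro tendstoD) auto
  moreover have "eventually (\<lambda>F. finite F \<and> F \<subseteq> A) (finite_subsets_at_top A)"
    by (intro eventually_finite_subsets_at_top_weakI) auto
  ultimately show "eventually (\<lambda>F. dist (sum f F) l < e) (finite_subsets_at_top A)"
  proof eventually_elim
    case (elim F)
    have "sum f F - l = (sum f F - sum g F) + (sum g F - c) + (c - l)" by simp
    then have "cmod (sum f F - l) \<le> cmod (sum f F - sum g F) + cmod (sum g F - c) + cmod (c - l)"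
      by (metis norm_triangle_ineq norm_triangle_le add_right_mono)
    also have "\<dots> \<le> e / 4 + e / 4 + e / 4"
      using elim g by (intro add_mono) (auto simp: dist_norm)
    also have "\<dots> < e" using \<open>e > 0\<close> by simp
    finally show ?case by (simp add: dist_norm)
  qed
qed

lemma has_sum_sum:
  fixes f :: "'i \<Rightarrow> 'a \<Rightarrow> complex"
  assumes "\<And>i. i \<in> I \<Longrightarrow> (f i has_sum c i) A"
  shows "((\<lambda>x. \<Sum>i\<in>I. f i x) has_sum (\<Sum>i\<in>I. c i)) A"
  using assms by (induction I rule: infinite_finite_induct) (auto intro: has_sum_add)

definition null_seqs :: "(nat \<Rightarrow> complex) set" where
  "null_seqs = {x. x \<longlonglongrightarrow> 0}"

lemma null_seqs_finite_gt: "finite {j. P (x j)}"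
  if x: "x \<in> null_seqs" and "r > 0" and P: "\<And>z. P z \<Longrightarrow> cmod z > r"
proof -
  have "eventually (\<lambda>j. cmod (x j) < r) sequentially"
    using x \<open>r > 0\<close> unfolding null_seqs_def tendsto_iff by (auto simp: dist_norm)
  then obtain N where N: "\<And>j. j \<ge> N \<Longrightarrow> cmod (x j) < r" by (auto simp: eventually_sequentially)
  have "{j. P (x j)} \<subseteq> {..<N}"
  proof
    fix j assume "j \<in> {j. P (x j)}"
    then have "\<not> cmod (x j) < r" using P[of "x j"] by simp
    then show "j \<in> {..<N}" using N[of j] by (meson lessThan_iff not_le)
  qed
  then show ?thesis by (rule finite_subset) simp
qed

text \<open>Subtract half of the bound, with the right phase, wherever the real or the imaginary
  part exceeds half of the bound in modulus. These places form four finite sets, because the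
  sequence tends to zero, so the subtracted sequence is the image of a combination of four basis
  vectors. Real and imaginary parts are treated separately because then the bound is halved exactly.\<close>

lemma halve_null_seq:
  assumes x: "x \<in> null_seqs" and r: "\<And>j. \<bar>Re (x j)\<bar> \<le> r" "\<And>j. \<bar>Im (x j)\<bar> \<le> r"
  shows "\<exists>z y. y \<in> null_seqs \<and> (\<forall>j. \<bar>Re (y j)\<bar> \<le> r / 2 \<and> \<bar>Im (y j)\<bar> \<le> r / 2) \<and>
    (\<forall>F. finite F \<longrightarrow> (\<Sum>a\<in>F. cmod (z a)) \<le> 2 * r) \<and>
    (\<forall>j. (z has_sum (x j - y j)) {a. j \<in> set_decode a})"
proof -
  have r0: "0 \<le> r" using r(1)[of 0] by linarith
  \<comment> \<open>The four half planes; for \<open>r = 0\<close> they are emptied, since nothing has to be subtracted.\<close>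
  define P where "P = (\<lambda>(k::nat) (w::complex). r > 0 \<and>
     (if k = 0 then Re w > r/2 else if k = 1 then Re w < -r/2 else if k = 2 then Im w > r/2 else Im w < -r/2))"
  define u where "u = (\<lambda>k::nat. if k = 0 then 1 else if k = 1 then -1 else if k = 2 then \<i> else -\<i>)"
  have u1: "cmod (u k) = 1" for k by (simp add: u_def)
  have fin: "finite {j. P k (x j)}" for k
  proof (cases "r > 0")
    case True
    have "cmod w > r / 2" if "P k w" for w
      using that abs_Re_le_cmod[of w] abs_Im_le_cmod[of w] by (auto simp: P_def split: if_splits)
    then show ?thesis using True by (intro null_seqs_finite_gt[OF x, of "r/2"]) auto
  qed (simp add: P_def)
  define A where "A = (\<lambda>k. set_encode {j. P k (x j)})"
  have dA: "j \<in> set_decode (A k) \<longleftrightarrow> P k (x j)" for j k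
    using fin by (simp add: A_def)
  define z where "z = (\<lambda>a. \<Sum>k<4. if a = A k then of_real (r/2) * u k else 0)"
  define w where "w = (\<lambda>j. \<Sum>k<4. if P k (x j) then of_real (r/2) * u k else 0)"
  have "((\<lambda>a. if a = A k then of_real (r/2) * u k else 0) has_sum (if P k (x j) then of_real (r/2) * u k else 0))
     {a. j \<in> set_decode a}" for k j
    by (rule has_sum_finite_neutralI[where B = "{A k} \<inter> {a. j \<in> set_decode a}"]) (auto simp: dA)
  then have sum: "(z has_sum w j) {a. j \<in> set_decode a}" for j
    unfolding z_def w_def by (intro has_sum_sum) auto
  have "x j - (x j - w j) = w j" for j by simp
  have zF: "(\<Sum>a\<in>F. cmod (z a)) \<le> 2 * r" if "finite F" for F
  proof -
    have "(\<Sum>a\<in>F. cmod (z a)) \<le> (\<Sum>a\<in>F. \<Sum>k<4. if a = A k then r/2 else 0)"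
      unfolding z_def using r0 by (intro sum_mono sum_norm_le) (auto simp: norm_mult u1)
    also have "\<dots> = (\<Sum>k<4. \<Sum>a\<in>F. if a = A k then r/2 else 0)" by (rule sum.swap)
    also have "\<dots> \<le> (\<Sum>k<4::nat. r/2)" using r0 that by (intro sum_mono) (simp add: sum.delta)
    finally show ?thesis by simp
  qed
  define y where "y = (\<lambda>j. x j - w j)"
  have w4: "w j = (if P 0 (x j) then of_real (r/2) else 0) - (if P 1 (x j) then of_real (r/2) else 0)
     + (if P 2 (x j) then of_real (r/2) * \<i> else 0) - (if P 3 (x j) then of_real (r/2) * \<i> else 0)" for j
    by (simp add: w_def u_def eval_nat_numeral)
  have half: "\<bar>Re (y j)\<bar> \<le> r / 2 \<and> \<bar>Im (y j)\<bar> \<le> r / 2" for j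
    unfolding y_def w4 using r(1)[of j] r(2)[of j] by (auto simp: P_def)
  have "y \<in> null_seqs"
  proof -
    have "finite (\<Union>k<4. {j. P k (x j)})" using fin by blast
    then have "eventually (\<lambda>j. j \<notin> (\<Union>k<4. {j. P k (x j)})) cofinite"
      by (simp add: eventually_cofinite)
    then have "eventually (\<lambda>j. j \<notin> (\<Union>k<4. {j. P k (x j)})) sequentially"
      by (simp add: cofinite_eq_sequentially)
    then have "eventually (\<lambda>j. y j = x j) sequentially"
      by eventually_elim (auto simp: y_def w_def)
    then show ?thesis using x unfolding null_seqs_def by (auto simp: tendsto_cong)
  qed
  then show ?thesis
    using half zF sum by (intro exI[of _ z] exI[of _ y]) (auto simp: y_def)
qed

text \<open>Iterating the halving step yields a geometric series of corrections.\<close>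

lemma null_seq_selection_bound:
  assumes x: "x \<in> null_seqs" and r: "\<And>j. cmod (x j) \<le> r"
  shows "\<exists>s. (\<forall>F. finite F \<longrightarrow> (\<Sum>a\<in>F. cmod (s a)) \<le> 4 * r) \<and> (\<forall>j. (s has_sum x j) {a. j \<in> set_decode a})"
proof -
  \<comment> \<open>\<open>B n\<close> bounds the remainder after \<open>n\<close> steps, and \<open>R n\<close> describes the correction of step \<open>n\<close>.\<close>
  define B where "B = (\<lambda>n y. y \<in> null_seqs \<and> (\<forall>j. \<bar>Re (y j)\<bar> \<le> r / 2 ^ n \<and> \<bar>Im (y j)\<bar> \<le> r / 2 ^ n))"
  define R where "R = (\<lambda>n y y' z. (\<forall>F. finite F \<longrightarrow> (\<Sum>a\<in>F. cmod (z a)) \<le> 2 * (r / 2 ^ n)) \<and>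
    (\<forall>j. (z has_sum (y j - y' j :: complex)) {a. j \<in> set_decode a}))"
  have r0: "0 \<le> r" using norm_ge_zero r by (rule order_trans)
  have step: "\<exists>y'. B (Suc n) y' \<and> (\<exists>z. R n y y' z)" if "B n y" for n y
  proof -
    have B: "y \<in> null_seqs" "\<And>j. \<bar>Re (y j)\<bar> \<le> r / 2 ^ n" "\<And>j. \<bar>Im (y j)\<bar> \<le> r / 2 ^ n"
      using that by (auto simp: B_def)
    have "r / 2 ^ n / 2 = r / 2 ^ Suc n" by simp
    then show ?thesis using halve_null_seq[OF B] unfolding B_def R_def by metis
  qed
  have B0: "B 0 x"
    unfolding B_def using x r abs_Re_le_cmod abs_Im_le_cmod by (auto intro: order_trans)
  obtain X where X: "X 0 = x" "\<And>n. B n (X n)" "\<And>n. \<exists>z. R n (X n) (X (Suc n)) z"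
  proof -
    have "\<exists>f. f 0 = x \<and> (\<forall>n. B n (f n) \<and> (\<exists>z. R n (f n) (f (Suc n)) z))"
    proof -
      have "\<exists>f. \<forall>n. (B n (f n) \<and> (n = 0 \<longrightarrow> f n = x)) \<and> (\<exists>z. R n (f n) (f (Suc n)) z)"
        by (rule dependent_nat_choice) (use B0 step in auto)
      then show ?thesis by auto
    qed
    then show thesis using that by blast
  qed
  obtain Z where Z: "\<And>n. R n (X n) (X (Suc n)) (Z n)" using X(3) by metis
  have ZF: "(\<Sum>a\<in>F. cmod (Z n a)) \<le> 2 * r / 2 ^ n" if "finite F" for F n
    using Z[of n] that by (simp add: R_def)
  have Zs: "(Z n has_sum (X n j - X (Suc n) j)) {a. j \<in> set_decode a}" for n j
    using Z[of n] by (simp add: R_def)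
  have geo: "(\<lambda>n. 2 * r / 2 ^ (n + N)) sums (4 * r / 2 ^ N)" for N
    using sums_mult[OF geometric_sums[of "1/2::real"], of "2 * r / 2 ^ N"]
    by (simp add: power_add power_one_over field_simps)
  have Zle: "cmod (Z n a) \<le> 2 * r / 2 ^ n" for n a using ZF[of "{a}" n] by simp
  have sumZ: "summable (\<lambda>n. cmod (Z n a))" for a
    by (rule summable_comparison_test[OF _ sums_summable[OF geo[of 0]]]) (use Zle in auto)
  define s where "s = (\<lambda>a. \<Sum>n. Z n a)"
  have tail: "(\<Sum>a\<in>F. cmod (s a - (\<Sum>n<N. Z n a))) \<le> 4 * r / 2 ^ N" if F: "finite F" for F N
  proof -
    have sN: "summable (\<lambda>n. cmod (Z (n + N) a))" for a
      using sumZ[of a] summable_iff_shift[of "\<lambda>n. cmod (Z n a)" N] by simp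
    have "cmod (s a - (\<Sum>n<N. Z n a)) \<le> (\<Sum>n. cmod (Z (n + N) a))" for a
    proof -
      have "s a - (\<Sum>n<N. Z n a) = (\<Sum>n. Z (n + N) a)"
        unfolding s_def using suminf_split_initial_segment[OF summable_norm_cancel[OF sumZ[of a]], of N] by simp
      then show ?thesis using summable_norm[OF sN[of a]] by simp
    qed
    then have "(\<Sum>a\<in>F. cmod (s a - (\<Sum>n<N. Z n a))) \<le> (\<Sum>a\<in>F. \<Sum>n. cmod (Z (n + N) a))"
      by (rule sum_mono)
    also have "\<dots> = (\<Sum>n. \<Sum>a\<in>F. cmod (Z (n + N) a))" by (rule suminf_sum[symmetric]) (rule sN)
    also have "\<dots> \<le> (\<Sum>n. 2 * r / 2 ^ (n + N))"
      by (intro suminf_le ZF F summable_sum sN sums_summable[OF geo])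
    also have "\<dots> = 4 * r / 2 ^ N" using sums_unique[OF geo] by simp
    finally show ?thesis .
  qed
  have pow: "\<exists>N. K / 2 ^ N \<le> e" if "e > 0" for e K :: real
  proof -
    have "(\<lambda>N. K * (1/2) ^ N) \<longlonglongrightarrow> K * 0" by (intro tendsto_intros) simp_all
    then have "eventually (\<lambda>N. K * (1/2) ^ N < e) sequentially" using that by (auto intro: order_tendstoD)
    then show ?thesis by (auto simp: eventually_sequentially power_one_over intro!: less_imp_le)
  qed
  have "(s has_sum x j) {a. j \<in> set_decode a}" for j
  proof (rule has_sum_approx)
    fix e :: real assume "e > 0"
    obtain N where N: "4 * r / 2 ^ N \<le> e" using pow[OF \<open>e > 0\<close>] by blast
    have "((\<lambda>a. \<Sum>n<N. Z n a) has_sum (\<Sum>n<N. X n j - X (Suc n) j)) {a. j \<in> set_decode a}"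
      by (intro has_sum_sum Zs)
    moreover have "(\<Sum>n<N. X n j - X (Suc n) j) = x j - X N j"
      using sum_lessThan_telescope'[of "\<lambda>n. X n j" N] X(1) by simp
    moreover have "cmod (x j - X N j - x j) \<le> e"
    proof -
      have "cmod (X N j) \<le> \<bar>Re (X N j)\<bar> + \<bar>Im (X N j)\<bar>" by (rule cmod_le)
      also have "\<dots> \<le> r / 2 ^ N + r / 2 ^ N" using X(2)[of N] unfolding B_def by (intro add_mono) auto
      also have "\<dots> \<le> 4 * r / 2 ^ N" using r0 by (simp add: field_simps)
      finally show ?thesis using N by simp
    qed
    moreover have "cmod (sum s F - (\<Sum>a\<in>F. \<Sum>n<N. Z n a)) \<le> e" if "finite F" for F
    proof -
      have "cmod (sum s F - (\<Sum>a\<in>F. \<Sum>n<N. Z n a)) \<le> (\<Sum>a\<in>F. cmod (s a - (\<Sum>n<N. Z n a)))"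
        unfolding sum_subtractf[symmetric] by (rule norm_sum)
      also have "\<dots> \<le> e" using tail[OF that] N by (rule order_trans)
      finally show ?thesis .
    qed
    ultimately show "\<exists>g c. (g has_sum c) {a. j \<in> set_decode a} \<and> cmod (c - x j) \<le> e \<and>
        (\<forall>F. finite F \<longrightarrow> F \<subseteq> {a. j \<in> set_decode a} \<longrightarrow> cmod (sum s F - sum g F) \<le> e)"
      by (intro exI[of _ "\<lambda>a. \<Sum>n<N. Z n a"] exI[of _ "x j - X N j"]) auto
  qed
  moreover have "(\<Sum>a\<in>F. cmod (s a)) \<le> 4 * r" if "finite F" for F
    using tail[OF that, of 0] by simp
  ultimately show ?thesis by blast
qed

text \<open>There is a least bound; a lift that is good for it is good for every bound at once.\<close>

lemma null_seq_bounded: "\<exists>r. (\<forall>j. cmod (x j) \<le> r) \<and> (\<forall>r'. (\<forall>j. cmod (x j) \<le> r') \<longrightarrow> r \<le> r')"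
  if x: "x \<in> null_seqs"
proof -
  have "Bseq x" using x convergentI convergent_imp_Bseq unfolding null_seqs_def by blast
  then have "bdd_above (range (\<lambda>j. cmod (x j)))" by (auto simp: Bseq_def)
  then show ?thesis
    by (intro exI[of _ "SUP j. cmod (x j)"]) (auto intro: cSUP_upper cSUP_least)
qed

text \<open>A right inverse of the quotient map from \<open>l\<^sub>1\<close> onto
  \<open>c\<^sub>0\<close> that sends the basis vector with index \<open>a\<close> to the indicator
  function of \<open>set_decode a\<close>. It is not linear.\<close>

definition lift_null_seq :: "(nat \<Rightarrow> complex) \<Rightarrow> nat \<Rightarrow> complex" where
  "lift_null_seq x = (SOME s. (\<forall>r F. (\<forall>j. cmod (x j) \<le> r) \<longrightarrow> finite F \<longrightarrow> (\<Sum>a\<in>F. cmod (s a)) \<le> 4 * r) \<and>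
     (\<forall>j. (s has_sum x j) {a. j \<in> set_decode a}))"

lemma lift_null_seq:
  assumes x: "x \<in> null_seqs"
  shows "(\<forall>j. cmod (x j) \<le> r) \<Longrightarrow> finite F \<Longrightarrow> (\<Sum>a\<in>F. cmod (lift_null_seq x a)) \<le> 4 * r"
    and "(lift_null_seq x has_sum x j) {a. j \<in> set_decode a}"
proof -
  obtain r0 where r0: "\<forall>j. cmod (x j) \<le> r0" "\<And>r'. (\<forall>j. cmod (x j) \<le> r') \<Longrightarrow> r0 \<le> r'"
    using null_seq_bounded[OF x] by blast
  obtain s where s: "\<forall>F. finite F \<longrightarrow> (\<Sum>a\<in>F. cmod (s a)) \<le> 4 * r0" "\<forall>j. (s has_sum x j) {a. j \<in> set_decode a}"
    using null_seq_selection_bound[OF x] r0(1) by blast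
  have "(\<forall>r F. (\<forall>j. cmod (x j) \<le> r) \<longrightarrow> finite F \<longrightarrow> (\<Sum>a\<in>F. cmod (s a)) \<le> 4 * r) \<and>
     (\<forall>j. (s has_sum x j) {a. j \<in> set_decode a})"
    using s r0(2) by (meson mult_left_mono order_trans zero_le_numeral)
  from someI[of "\<lambda>s. (\<forall>r F. (\<forall>j. cmod (x j) \<le> r) \<longrightarrow> finite F \<longrightarrow> (\<Sum>a\<in>F. cmod (s a)) \<le> 4 * r) \<and>
     (\<forall>j. (s has_sum x j) {a. j \<in> set_decode a})", OF this]
  show "(\<forall>j. cmod (x j) \<le> r) \<Longrightarrow> finite F \<Longrightarrow> (\<Sum>a\<in>F. cmod (lift_null_seq x a)) \<le> 4 * r"
    and "(lift_null_seq x has_sum x j) {a. j \<in> set_decode a}"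
    unfolding lift_null_seq_def by blast+
qed

section \<open>The two spaces\<close>

definition pair_set :: "nat \<Rightarrow> (nat \<times> nat) set" where
  "pair_set m = prod_decode ` set_decode m"

definition pair_code :: "(nat \<times> nat) set \<Rightarrow> nat" where
  "pair_code F = set_encode (prod_encode ` F)"

lemma finite_pair_set [simp]: "finite (pair_set m)"
  by (simp add: pair_set_def)

lemma pair_set_code [simp]: "finite F \<Longrightarrow> pair_set (pair_code F) = F"
  by (simp add: pair_set_def pair_code_def image_image)

lemma pair_code_set [simp]: "pair_code (pair_set m) = m"
  by (simp add: pair_set_def pair_code_def image_image)

text \<open>The diagonal of the operator that represents \<open>(y, q)\<close>. Sums over all finite
  sets norm \<open>l\<^sub>1\<close> up to the factor \<open>4\<close>; in the same way, sums over
  finite partial functions norm the \<open>l\<^sub>1\<close>-sum of copies of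
  \<open>c\<^sub>0\<close>, since such a function picks one entry of each of finitely many rows.
  Even positions carry the first kind, odd positions the second.\<close>

definition coords :: "(nat \<times> nat \<Rightarrow> complex) \<Rightarrow> (nat \<times> nat \<Rightarrow> complex) \<Rightarrow> nat \<Rightarrow> complex" where
  "coords y q t = (if even t then sum y (pair_set (t div 2))
     else if single_valued (pair_set (t div 2)) then sum q (pair_set (t div 2)) else 0)"

definition y_index :: "(nat \<times> nat) set \<Rightarrow> nat" where "y_index F = 2 * pair_code F"
definition q_index :: "(nat \<times> nat) set \<Rightarrow> nat" where "q_index G = 2 * pair_code G + 1"

lemma coords_y_index [simp]: "coords y q (y_index F) = sum y F" if "finite F"
  using that by (simp add: coords_def y_index_def)

lemma coords_q_index [simp]: "coords y q (q_index G) = sum q G" if "finite G" "single_valued G"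
  using that by (simp add: coords_def q_index_def)

lemma single_valued_singleton [simp]: "single_valued {p}"
  by (auto simp: single_valued_def)

lemma coords_add: "coords y q + coords y' q' = coords (\<lambda>p. y p + y' p) (\<lambda>p. q p + q' p)"
  by (auto simp: coords_def fun_eq_iff sum.distrib)

lemma coords_diff: "coords y q t - coords y' q' t = coords (\<lambda>p. y p - y' p) (\<lambda>p. q p - q' p) t"
  by (auto simp: coords_def sum_subtractf)

lemma coords_scale: "(\<lambda>t. c * coords y q t) = coords (\<lambda>p. c * y p) (\<lambda>p. c * q p)"
  by (auto simp: coords_def fun_eq_iff sum_distrib_left)

lemma coords_le:
  assumes "\<And>F. finite F \<Longrightarrow> cmod (sum y F) \<le> r" "\<And>G. finite G \<Longrightarrow> single_valued G \<Longrightarrow> cmod (sum q G) \<le> r"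
  shows "cmod (coords y q t) \<le> r"
proof -
  have "0 \<le> r" using assms(1)[of "{}"] by simp
  then show ?thesis using assms by (auto simp: coords_def)
qed

lemma sum_y_le:
  assumes "\<And>t. cmod (coords y q t) \<le> r" "finite F"
  shows "cmod (sum y F) \<le> r"
  using assms(1)[of "y_index F"] assms(2) by simp

lemma sum_q_le:
  assumes "\<And>t. cmod (coords y q t) \<le> r" "finite G" "single_valued G"
  shows "cmod (sum q G) \<le> r"
  using assms(1)[of "q_index G"] assms(2,3) by simp

lemma sum_abs_y_le:
  assumes "\<And>t. cmod (coords y q t) \<le> r" "finite F"
  shows "(\<Sum>p\<in>F. cmod (y p)) \<le> 4 * r"
proof -
  have "(\<Sum>p\<in>F. cmod (y p)) \<le> 2 * real DIM(complex) * r"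
    by (rule sum_norm_allsubsets_bound[OF assms(2)]) (rule sum_y_le[OF assms(1)], use assms finite_subset in blast)
  then show ?thesis by simp
qed

lemma sum_abs_q_le:
  assumes "\<And>t. cmod (coords y q t) \<le> r" "finite G" "single_valued G"
  shows "(\<Sum>p\<in>G. cmod (q p)) \<le> 4 * r"
proof -
  have "(\<Sum>p\<in>G. cmod (q p)) \<le> 2 * real DIM(complex) * r"
  proof (rule sum_norm_allsubsets_bound[OF assms(2)])
    fix Q assume "Q \<subseteq> G"
    then show "cmod (sum q Q) \<le> r"
      using assms(2,3) by (intro sum_q_le[OF assms(1)]) (auto intro: finite_subset single_valued_subset)
  qed
  then show ?thesis by simp
qed

lemma entry_q_le: "cmod (q p) \<le> r" if "\<And>t. cmod (coords y q t) \<le> r"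
  using sum_q_le[OF that, of "{p}"] by simp

lemma single_valued_graph: "single_valued ((\<lambda>k. (k, i k)) ` K)"
  by (auto simp: single_valued_def)

lemma single_valued_obtain_graph:
  assumes "single_valued G"
  obtains i where "G = (\<lambda>k. (k, i k)) ` fst ` G"
proof -
  have "\<forall>k. \<exists>j. k \<in> fst ` G \<longrightarrow> (k, j) \<in> G" by force
  then obtain i where i: "\<And>k. k \<in> fst ` G \<Longrightarrow> (k, i k) \<in> G" by metis
  have "G = (\<lambda>k. (k, i k)) ` fst ` G"
  proof (intro equalityI subsetI)
    fix p assume p: "p \<in> G"
    then have "(fst p, snd p) \<in> G" "(fst p, i (fst p)) \<in> G" using i by auto
    then have "snd p = i (fst p)" using assms single_valuedD by metis
    then have "p = (fst p, i (fst p))" by (simp add: prod_eq_iff)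
    then show "p \<in> (\<lambda>k. (k, i k)) ` fst ` G" using p by blast
  qed (use i in auto)
  then show thesis by (rule that)
qed

lemma sum_graph: "(\<Sum>p\<in>(\<lambda>k. (k, i k)) ` K. f p) = (\<Sum>k\<in>K. f (k, i k))"
  by (subst sum.reindex) (auto simp: inj_on_def)

text \<open>Boundedness of the coordinates says that \<open>y\<close> is summable and that the
  suprema of the rows of \<open>q\<close> are summable. The last condition says that the quotient
  map sends the row \<open>y(k, \<cdot>)\<close> to \<open>q(\<sigma> k, \<cdot>) / 2^k\<close>.\<close>

definition admissible :: "(nat \<Rightarrow> nat) \<Rightarrow> (nat \<times> nat \<Rightarrow> complex) \<Rightarrow> (nat \<times> nat \<Rightarrow> complex) \<Rightarrow> bool" where
  "admissible \<sigma> y q \<longleftrightarrow> coords y q \<in> bounded_seqs \<and> (\<forall>k. (\<lambda>j. q (k, j)) \<in> null_seqs) \<and>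
     (\<forall>k j. ((\<lambda>a. y (k, a)) has_sum (q (\<sigma> k, j) / 2 ^ k)) {a. j \<in> set_decode a})"

definition coord_space :: "(nat \<Rightarrow> nat) \<Rightarrow> (nat \<Rightarrow> complex) set" where
  "coord_space \<sigma> = {coords y q | y q. admissible \<sigma> y q}"

lemma coord_space_bounded: "coord_space \<sigma> \<subseteq> bounded_seqs"
  by (auto simp: coord_space_def admissible_def)

definition y_part :: "(nat \<Rightarrow> complex) \<Rightarrow> nat \<times> nat \<Rightarrow> complex" where "y_part v p = v (y_index {p})"
definition q_part :: "(nat \<Rightarrow> complex) \<Rightarrow> nat \<times> nat \<Rightarrow> complex" where "q_part v p = v (q_index {p})"

lemma y_part_coords [simp]: "y_part (coords y q) = y"
  by (simp add: y_part_def fun_eq_iff)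

lemma q_part_coords [simp]: "q_part (coords y q) = q"
  by (simp add: q_part_def fun_eq_iff)

lemma coord_space_parts:
  assumes "v \<in> coord_space \<sigma>"
  shows "admissible \<sigma> (y_part v) (q_part v)" "coords (y_part v) (q_part v) = v"
  using assms by (auto simp: coord_space_def)

lemma bounded_seqs_add: "a + b \<in> bounded_seqs" if ab: "a \<in> bounded_seqs" "b \<in> bounded_seqs"
proof -
  obtain r s where rs: "\<forall>i. cmod (a i) \<le> r" "\<forall>i. cmod (b i) \<le> s" using ab by (auto simp: bounded_seqs_def)
  have "cmod (a i + b i) \<le> r + s" for i
    using norm_triangle_ineq[of "a i" "b i"] rs by (meson add_mono order_trans)
  then show ?thesis by (auto simp: bounded_seqs_def)
qed

lemma bounded_seqs_scale: "(\<lambda>i. c * a i) \<in> bounded_seqs" if a: "a \<in> bounded_seqs"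
proof -
  obtain r where "\<forall>i. cmod (a i) \<le> r" using a by (auto simp: bounded_seqs_def)
  then have "\<forall>i. cmod (c * a i) \<le> cmod c * r" by (simp add: norm_mult mult_left_mono)
  then show ?thesis unfolding bounded_seqs_def by blast
qed

lemma coord_space_0: "0 \<in> coord_space \<sigma>"
proof -
  have "admissible \<sigma> (\<lambda>_. 0) (\<lambda>_. 0)"
    by (auto simp: admissible_def coords_def bounded_seqs_def null_seqs_def intro!: exI[of _ 0] has_sum_0)
  moreover have "coords (\<lambda>_. 0) (\<lambda>_. 0) = 0" by (auto simp: coords_def fun_eq_iff)
  ultimately show ?thesis unfolding coord_space_def by force
qed

lemma coord_space_add:
  assumes "v \<in> coord_space \<sigma>" "w \<in> coord_space \<sigma>"
  shows "v + w \<in> coord_space \<sigma>"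
proof -
  obtain y q y' q' where v: "v = coords y q" "admissible \<sigma> y q" and w: "w = coords y' q'" "admissible \<sigma> y' q'"
    using assms by (auto simp: coord_space_def)
  have "admissible \<sigma> (\<lambda>p. y p + y' p) (\<lambda>p. q p + q' p)"
    using v(2) w(2) bounded_seqs_add[of "coords y q" "coords y' q'"]
    unfolding admissible_def coords_add
    by (auto simp: null_seqs_def add_divide_distrib intro: tendsto_add_zero has_sum_add)
  then show ?thesis unfolding v w coords_add coord_space_def by blast
qed

lemma coord_space_scale:
  assumes "v \<in> coord_space \<sigma>"
  shows "(\<lambda>i. c * v i) \<in> coord_space \<sigma>"
proof -
  obtain y q where v: "v = coords y q" "admissible \<sigma> y q" using assms by (auto simp: coord_space_def)
  have "((\<lambda>a. c * y (k, a)) has_sum (c * q (\<sigma> k, j) / 2 ^ k)) {a. j \<in> set_decode a}" for k j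
    using v(2) has_sum_cmult_right[of "\<lambda>a. y (k, a)" "{a. j \<in> set_decode a}" "q (\<sigma> k, j) / 2 ^ k" c]
    by (auto simp: admissible_def)
  then have "admissible \<sigma> (\<lambda>p. c * y p) (\<lambda>p. c * q p)"
    using v(2) bounded_seqs_scale[of "coords y q" c]
    unfolding admissible_def coords_scale by (auto simp: null_seqs_def intro: tendsto_mult_right_zero)
  then show ?thesis unfolding v coords_scale coord_space_def by blast
qed

lemma sum_row: "sum y ({k} \<times> F) = (\<Sum>a\<in>F. y (k, a))"
proof -
  have "{k} \<times> F = Pair k ` F" by auto
  then show ?thesis by (simp add: sum.reindex inj_on_def)
qed

text \<open>Uniform closeness of the coordinates controls all finite sums of \<open>y\<close> at
  once, so it carries over both the null sequences and the sums in the quotient condition.\<close>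

lemma coord_space_closed:
  assumes near: "\<And>e. e > 0 \<Longrightarrow> \<exists>b\<in>coord_space \<sigma>. \<forall>i. cmod (a i - b i) \<le> e"
  shows "a \<in> coord_space \<sigma>"
proof -
  define y where "y = y_part a"
  define q where "q = q_part a"
  have approx: "\<exists>y' q'. admissible \<sigma> y' q' \<and> (\<forall>t. cmod (a t - coords y' q' t) \<le> e)" if "e > 0" for e
    using near[OF that] by (auto simp: coord_space_def)
  then have "\<exists>y' q'. admissible \<sigma> y' q' \<and> (\<forall>t. cmod (a t - coords y' q' t) \<le> 1 / real (Suc n))" for n
    by simp
  then obtain Y Q where YQ: "\<And>n t. cmod (a t - coords (Y n) (Q n) t) \<le> 1 / real (Suc n)" by metis
  have lim: "(\<lambda>n. coords (Y n) (Q n) t) \<longlonglongrightarrow> a t" for t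
  proof (rule LIMSEQ_I)
    fix e :: real assume "e > 0"
    then obtain N where N: "1 / real (Suc N) < e" using reals_Archimedean by (auto simp: inverse_eq_divide)
    have "norm (coords (Y n) (Q n) t - a t) < e" if "n \<ge> Suc N" for n
    proof -
      have "1 / real (Suc n) \<le> 1 / real (Suc N)" using that by (intro divide_left_mono) auto
      with YQ[of t n] N show ?thesis by (simp add: norm_minus_commute)
    qed
    then show "\<exists>no. \<forall>n\<ge>no. norm (coords (Y n) (Q n) t - a t) < e" by blast
  qed
  have limy: "(\<lambda>n. Y n p) \<longlonglongrightarrow> y p" for p using lim[of "y_index {p}"] by (simp add: y_def y_part_def)
  have limq: "(\<lambda>n. Q n p) \<longlonglongrightarrow> q p" for p
    using lim[of "q_index {p}"] by (simp add: q_def q_part_def)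
  have "a t = coords y q t" for t
  proof (rule LIMSEQ_unique[OF lim])
    show "(\<lambda>n. coords (Y n) (Q n) t) \<longlonglongrightarrow> coords y q t"
      unfolding coords_def by (auto intro!: tendsto_sum limy limq)
  qed
  then have a: "a = coords y q" by auto
  have "admissible \<sigma> y q"
    unfolding admissible_def
  proof (intro conjI allI)
    obtain y' q' where b: "admissible \<sigma> y' q'" "\<And>t. cmod (a t - coords y' q' t) \<le> 1" using approx[of 1] by auto
    then obtain r where r: "\<And>t. cmod (coords y' q' t) \<le> r" by (auto simp: admissible_def bounded_seqs_def)
    have "cmod (a t) \<le> 1 + r" for t
      using norm_triangle_ineq[of "a t - coords y' q' t" "coords y' q' t"] b(2)[of t] r[of t] by simp
    then show "coords y q \<in> bounded_seqs" unfolding a bounded_seqs_def by blast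
  next
    fix k
    show "(\<lambda>j. q (k, j)) \<in> null_seqs"
      unfolding null_seqs_def
    proof (intro CollectI tendstoI)
      fix e :: real assume e: "e > 0"
      obtain y' q' where b: "admissible \<sigma> y' q'" "\<And>t. cmod (a t - coords y' q' t) \<le> e / 2"
        using approx[of "e/2"] e by auto
      have d: "cmod (q (k, j) - q' (k, j)) \<le> e / 2" for j
        using b(2)[of "q_index {(k, j)}"] by (simp add: a single_valued_def)
      have "eventually (\<lambda>j. dist (q' (k, j)) 0 < e / 2) sequentially"
        using b(1) e by (intro tendstoD) (auto simp: admissible_def null_seqs_def)
      then show "eventually (\<lambda>j. dist (q (k, j)) 0 < e) sequentially"
      proof eventually_elim
        case (elim j)
        then show ?case using d[of j] norm_triangle_ineq[of "q (k, j) - q' (k, j)" "q' (k, j)"] by simp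
      qed
    qed
  next
    fix k j
    show "((\<lambda>a. y (k, a)) has_sum (q (\<sigma> k, j) / 2 ^ k)) {a. j \<in> set_decode a}"
    proof (rule has_sum_approx)
      fix e :: real assume e: "e > 0"
      obtain y' q' where b: "admissible \<sigma> y' q'" "\<And>t. cmod (a t - coords y' q' t) \<le> e" using approx[OF e] by auto
      have "cmod (q' (\<sigma> k, j) / 2 ^ k - q (\<sigma> k, j) / 2 ^ k) \<le> e"
      proof -
        have "cmod (q' (\<sigma> k, j) - q (\<sigma> k, j)) \<le> e"
          using b(2)[of "q_index {(\<sigma> k, j)}"] by (simp add: a single_valued_def norm_minus_commute)
        moreover have "e \<le> e * 2 ^ k" using e by simp
        ultimately have "cmod (q' (\<sigma> k, j) - q (\<sigma> k, j)) \<le> e * 2 ^ k" by linarith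
        then show ?thesis by (simp add: norm_divide norm_power field_simps flip: diff_divide_distrib)
      qed
      moreover have "cmod ((\<Sum>a\<in>F. y (k, a)) - (\<Sum>a\<in>F. y' (k, a))) \<le> e" if "finite F" for F
        using b(2)[of "y_index ({k} \<times> F)"] that by (simp add: a sum_row)
      ultimately show "\<exists>g c. (g has_sum c) {a. j \<in> set_decode a} \<and> cmod (c - q (\<sigma> k, j) / 2 ^ k) \<le> e \<and>
          (\<forall>F. finite F \<longrightarrow> F \<subseteq> {a. j \<in> set_decode a} \<longrightarrow> cmod ((\<Sum>a\<in>F. y (k, a)) - sum g F) \<le> e)"
        using b(1) unfolding admissible_def by blast
    qed
  qed
  then show ?thesis unfolding a coord_space_def by blast
qed

lemma operator_space_coord_space: "operator_space ell2 (diag ` coord_space \<sigma>)"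
  by (rule operator_space_diag[OF coord_space_bounded coord_space_closed coord_space_0 coord_space_add coord_space_scale])

text \<open>Finitely supported pairs with values in \<open>D\<close>. They approximate the space
  from outside, because truncation destroys the quotient condition.\<close>

definition finite_coords :: "complex set \<Rightarrow> (nat \<Rightarrow> complex) set" where
  "finite_coords D = (\<Union>(P, Q) \<in> {P. finite P} \<times> {Q. finite Q}.
     (\<lambda>(f, g). coords (\<lambda>p. if p \<in> P then f p else 0) (\<lambda>p. if p \<in> Q then g p else 0)) `
       ((P \<rightarrow>\<^sub>E D) \<times> (Q \<rightarrow>\<^sub>E D)))"

lemma countable_finite_coords: "countable (finite_coords D)" if "countable D"
proof -
  have "countable {P :: (nat \<times> nat) set. finite P}"
    using countable_Collect_finite by blast
  then show ?thesis
    unfolding finite_coords_def using that by (auto intro!: countable_UN countable_SIGMA countable_PiE)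
qed

lemma finite_coords_bounded: "finite_coords D \<subseteq> bounded_seqs"
proof
  fix v assume "v \<in> finite_coords D"
  then obtain P Q f g where PQ: "finite P" "finite Q"
    and v: "v = coords (\<lambda>p. if p \<in> P then f p else 0) (\<lambda>p. if p \<in> Q then g p else 0)"
    by (auto simp: finite_coords_def)
  have fin: "cmod (\<Sum>p\<in>F. if p \<in> P then f p else 0) \<le> (\<Sum>p\<in>P. cmod (f p))"
    if "finite P" "finite F" for P F and f :: "nat \<times> nat \<Rightarrow> complex"
  proof -
    have "cmod (\<Sum>p\<in>F. if p \<in> P then f p else 0) = cmod (\<Sum>p\<in>F \<inter> P. f p)"
      using that by (simp add: sum.inter_restrict)
    also have "\<dots> \<le> (\<Sum>p\<in>F \<inter> P. cmod (f p))" by (rule norm_sum)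
    also have "\<dots> \<le> (\<Sum>p\<in>P. cmod (f p))" using that by (intro sum_mono2) auto
    finally show ?thesis .
  qed
  have "cmod (v t) \<le> (\<Sum>p\<in>P. cmod (f p)) + (\<Sum>p\<in>Q. cmod (g p))" for t
    unfolding v
  proof (rule coords_le)
    have "0 \<le> (\<Sum>p\<in>P. cmod (f p))" "0 \<le> (\<Sum>p\<in>Q. cmod (g p))" by (simp_all add: sum_nonneg)
    then show "cmod (\<Sum>p\<in>F. if p \<in> P then f p else 0) \<le> (\<Sum>p\<in>P. cmod (f p)) + (\<Sum>p\<in>Q. cmod (g p))"
        "cmod (\<Sum>p\<in>F. if p \<in> Q then g p else 0) \<le> (\<Sum>p\<in>P. cmod (f p)) + (\<Sum>p\<in>Q. cmod (g p))"
      if "finite F" for F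
      using fin[OF PQ(1) that, of f] fin[OF PQ(2) that, of g] by linarith+
  qed
  then show "v \<in> bounded_seqs" by (auto simp: bounded_seqs_def)
qed

text \<open>The tail of \<open>y\<close> is small because \<open>y\<close> is summable. For
  \<open>q\<close>, all but finitely many rows are uniformly negligible, and each remaining row is a
  null sequence.\<close>

lemma finite_coords_dense:
  assumes D: "\<And>z e. e > 0 \<Longrightarrow> \<exists>d\<in>D. cmod (z - d) \<le> e"
    and a: "a \<in> coord_space \<sigma>" and "e > 0"
  shows "\<exists>c\<in>finite_coords D. \<forall>t. cmod (a t - c t) \<le> e"
proof -
  obtain y q where yq: "a = coords y q" "admissible \<sigma> y q" using a by (auto simp: coord_space_def)
  obtain r where r: "\<And>t. cmod (coords y q t) \<le> r" using yq(2) by (auto simp: admissible_def bounded_seqs_def)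
  have "\<exists>P. finite P \<and> (\<forall>F i. finite F \<longrightarrow> F \<inter> P = {} \<longrightarrow> (\<Sum>p\<in>F. cmod (y p)) \<le> e / 2)"
    using selection_sums_uniform_tail[of "\<lambda>_. y" "4 * r" "e / 2"] sum_abs_y_le[OF r] \<open>e > 0\<close> by simp
  then obtain P where P: "finite P" "\<And>F. finite F \<Longrightarrow> F \<inter> P = {} \<Longrightarrow> (\<Sum>p\<in>F. cmod (y p)) \<le> e / 2" by auto
  \<comment> \<open>The precision is shared between the points of the finite support; adding one avoids an empty denominator.\<close>
  define \<delta> where "\<delta> = e / (2 * (card P + 1))"
  have "\<delta> > 0" using \<open>e > 0\<close> by (simp add: \<delta>_def)
  have "\<forall>p. \<exists>d. d \<in> D \<and> cmod (y p - d) \<le> \<delta>" using D[OF \<open>\<delta> > 0\<close>] by blast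
  then obtain f where f: "\<And>p. f p \<in> D" "\<And>p. cmod (y p - f p) \<le> \<delta>" by metis
  define y' where "y' = (\<lambda>p. if p \<in> P then f p else 0)"
  have y': "cmod (\<Sum>p\<in>F. y p - y' p) \<le> e" if F: "finite F" for F
  proof -
    have "cmod (\<Sum>p\<in>F. y p - y' p) \<le> (\<Sum>p\<in>F. cmod (y p - y' p))" by (rule norm_sum)
    also have "\<dots> = (\<Sum>p\<in>F \<inter> P. cmod (y p - y' p)) + (\<Sum>p\<in>F - P. cmod (y p - y' p))"
      using F by (subst sum.union_disjoint[symmetric]) (auto simp: Int_Diff_Un)
    also have "\<dots> \<le> (\<Sum>p\<in>F \<inter> P. \<delta>) + (\<Sum>p\<in>F - P. cmod (y p))"
      using f by (intro add_mono sum_mono) (auto simp: y'_def)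
    also have "\<dots> \<le> (\<Sum>p\<in>P. \<delta>) + e / 2"
      using F P \<open>\<delta> > 0\<close> by (intro add_mono sum_mono2 P(2)) auto
    also have "\<dots> \<le> e" using \<open>e > 0\<close> by (simp add: \<delta>_def field_simps)
    finally show ?thesis .
  qed
  have "(\<Sum>k\<in>K. cmod (q (k, i k))) \<le> 4 * r" if "finite K" for K i
    using sum_abs_q_le[OF r finite_imageI[OF that] single_valued_graph, of i] by (simp add: sum_graph)
  then obtain K where K: "finite K"
     "\<And>F i. finite F \<Longrightarrow> F \<inter> K = {} \<Longrightarrow> (\<Sum>k\<in>F. cmod (q (k, i k))) \<le> e / 2"
    using selection_sums_uniform_tail[of "\<lambda>j k. q (k, j)" "4 * r" "e / 2"] \<open>e > 0\<close> by auto
  define \<eta> where "\<eta> = e / (2 * (card K + 1))"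
  have "\<eta> > 0" using \<open>e > 0\<close> by (simp add: \<eta>_def)
  have "\<exists>N. \<forall>j\<ge>N. cmod (q (k, j)) \<le> \<eta>" for k
  proof -
    have "(\<lambda>j. q (k, j)) \<longlonglongrightarrow> 0" using yq(2) by (auto simp: admissible_def null_seqs_def)
    then show ?thesis using \<open>\<eta> > 0\<close> by (fastforce dest: LIMSEQ_D[of _ _ \<eta>] intro: less_imp_le)
  qed
  then obtain N where N: "\<And>k j. j \<ge> N k \<Longrightarrow> cmod (q (k, j)) \<le> \<eta>" by metis
  define Q where "Q = (SIGMA k:K. {..<N k})"
  have Q: "finite Q" using K by (simp add: Q_def)
  have "\<forall>p. \<exists>d. d \<in> D \<and> cmod (q p - d) \<le> \<eta>" using D[OF \<open>\<eta> > 0\<close>] by blast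
  then obtain g where g: "\<And>p. g p \<in> D" "\<And>p. cmod (q p - g p) \<le> \<eta>" by metis
  define q' where "q' = (\<lambda>p. if p \<in> Q then g p else 0)"
  have qK: "cmod (q (k, j) - q' (k, j)) \<le> \<eta>" if "k \<in> K" for k j
    using that g(2)[of "(k, j)"] N[of k j] by (auto simp: q'_def Q_def)
  have q': "cmod (\<Sum>p\<in>G. q p - q' p) \<le> e" if G: "finite G" "single_valued G" for G
  proof -
    obtain i where i: "G = (\<lambda>k. (k, i k)) ` fst ` G" using single_valued_obtain_graph[OF G(2)] .
    define L where "L = fst ` G"
    have L: "finite L" using G by (simp add: L_def)
    have "cmod (\<Sum>p\<in>G. q p - q' p) \<le> (\<Sum>p\<in>G. cmod (q p - q' p))" by (rule norm_sum)
    also have "\<dots> = (\<Sum>k\<in>L. cmod (q (k, i k) - q' (k, i k)))"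
      unfolding L_def by (subst i) (rule sum_graph)
    also have "\<dots> = (\<Sum>k\<in>L \<inter> K. cmod (q (k, i k) - q' (k, i k))) + (\<Sum>k\<in>L - K. cmod (q (k, i k) - q' (k, i k)))"
      using L by (subst sum.union_disjoint[symmetric]) (auto simp: Int_Diff_Un)
    also have "\<dots> \<le> (\<Sum>k\<in>L \<inter> K. \<eta>) + (\<Sum>k\<in>L - K. cmod (q (k, i k)))"
      using qK by (intro add_mono sum_mono) (auto simp: q'_def Q_def)
    also have "\<dots> \<le> (\<Sum>k\<in>K. \<eta>) + e / 2"
      using L K \<open>\<eta> > 0\<close> by (intro add_mono sum_mono2 K(2)) auto
    also have "\<dots> \<le> e" using \<open>e > 0\<close> by (simp add: \<eta>_def field_simps)
    finally show ?thesis .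
  qed
  have "coords y' q' \<in> finite_coords D"
  proof -
    have eq: "y' = (\<lambda>p. if p \<in> P then restrict f P p else 0)" "q' = (\<lambda>p. if p \<in> Q then restrict g Q p else 0)"
      by (auto simp: y'_def q'_def)
    have "(restrict f P, restrict g Q) \<in> (P \<rightarrow>\<^sub>E D) \<times> (Q \<rightarrow>\<^sub>E D)" using f g by auto
    then have "coords y' q' \<in> (\<lambda>(f, g). coords (\<lambda>p. if p \<in> P then f p else 0) (\<lambda>p. if p \<in> Q then g p else 0)) `
        ((P \<rightarrow>\<^sub>E D) \<times> (Q \<rightarrow>\<^sub>E D))"
      by (rule rev_image_eqI) (simp only: eq prod.case)
    then show ?thesis unfolding finite_coords_def using P(1) Q by (intro UN_I[of "(P, Q)"]) simp_all
  qed
  moreover have "cmod (a t - coords y' q' t) \<le> e" for t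
    unfolding yq(1) coords_diff by (intro coords_le y' q')
  ultimately show ?thesis by blast
qed

lemma separable_coord_space: "separable_op_space ell2 (diag ` coord_space \<sigma>)"
proof -
  obtain D :: "complex set" where D: "countable D" "\<And>X. open X \<Longrightarrow> X \<noteq> {} \<Longrightarrow> \<exists>d\<in>D. d \<in> X"
    using countable_dense_exists by blast
  have dense: "\<exists>d\<in>D. cmod (z - d) \<le> e" if "e > 0" for z e
    using D(2)[of "ball z e"] that by (auto simp: dist_norm intro: less_imp_le)
  show ?thesis
    by (rule separable_op_space_diag[OF operator_space_coord_space coord_space_bounded
          countable_finite_coords[OF D(1)] finite_coords_bounded finite_coords_dense[OF dense]])
qed

section \<open>The nonlinear equivalence\<close>

text \<open>The correction by lifts turns the quotient parts \<open>q(\<sigma> k, \<cdot>)\<close>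
  of the rows of \<open>y\<close> into \<open>q(\<pi> (\<tau> k), \<cdot>)\<close>, which is what
  the permuted \<open>q\<close> requires in the space of \<open>\<tau>\<close>.\<close>

definition shifted_y ::
  "(nat \<Rightarrow> nat) \<Rightarrow> (nat \<Rightarrow> nat) \<Rightarrow> (nat \<Rightarrow> nat) \<Rightarrow> (nat \<times> nat \<Rightarrow> complex) \<Rightarrow> (nat \<times> nat \<Rightarrow> complex) \<Rightarrow> nat \<times> nat \<Rightarrow> complex" where
  "shifted_y \<sigma> \<tau> \<pi> y q = (\<lambda>(k, a). y (k, a) +
     (lift_null_seq (\<lambda>j. q (\<pi> (\<tau> k), j)) a - lift_null_seq (\<lambda>j. q (\<sigma> k, j)) a) / 2 ^ k)"

definition shifted_q :: "(nat \<Rightarrow> nat) \<Rightarrow> (nat \<times> nat \<Rightarrow> complex) \<Rightarrow> nat \<times> nat \<Rightarrow> complex" where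
  "shifted_q \<pi> q = (\<lambda>(k, j). q (\<pi> k, j))"

definition shift :: "(nat \<Rightarrow> nat) \<Rightarrow> (nat \<Rightarrow> nat) \<Rightarrow> (nat \<Rightarrow> nat) \<Rightarrow> (nat \<Rightarrow> complex) \<Rightarrow> nat \<Rightarrow> complex" where
  "shift \<sigma> \<tau> \<pi> v = coords (shifted_y \<sigma> \<tau> \<pi> (y_part v) (q_part v)) (shifted_q \<pi> (q_part v))"

text \<open>Composing \<open>q\<close> with \<open>\<pi>\<close> on the rows amounts to moving the
  finite partial functions by \<open>\<pi>\<close>; the positions of the first kind stay in place.\<close>

definition shift_index :: "(nat \<Rightarrow> nat) \<Rightarrow> nat \<Rightarrow> nat" where
  "shift_index \<pi> t = (if even t then t else q_index (map_prod \<pi> id ` pair_set (t div 2)))"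

lemma single_valued_map_fst: "single_valued (map_prod \<pi> id ` G) \<longleftrightarrow> single_valued G" if "inj \<pi>"
proof
  assume "single_valued (map_prod \<pi> id ` G)"
  then show "single_valued G" unfolding single_valued_def by force
next
  assume "single_valued G"
  then show "single_valued (map_prod \<pi> id ` G)"
    using that unfolding single_valued_def by (auto simp: inj_eq)
qed

lemma surj_shift_index: "surj (shift_index \<pi>)" if "bij \<pi>"
proof (rule surjI)
  fix t
  let ?p = "inv_into UNIV \<pi>"
  have c: "map_prod \<pi> id ` map_prod ?p id ` G = G" for G :: "(nat \<times> nat) set"
    using that by (force simp: image_image bij_is_surj surj_f_inv_f map_prod_def)
  show "shift_index \<pi> (shift_index ?p t) = t"
    by (auto simp: shift_index_def q_index_def c)
qed

lemma geometric_tail_le: "(\<Sum>k<N. if k < m then 0 else 1 / 2 ^ k) \<le> (2 / 2 ^ m :: real)"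
proof -
  have "(\<Sum>k<N. if k < m then 0 else 1 / 2 ^ k) = (if N \<le> m then 0 else 2 / 2 ^ m - 2 / 2 ^ N :: real)"
    by (induction N) (auto simp: not_le le_Suc_eq field_simps)
  then show ?thesis by auto
qed

text \<open>Row \<open>k\<close> is changed by two lifts of norm at most \<open>4 r\<close>, scaled
  by \<open>1 / 2^k\<close>; where \<open>\<pi> (\<tau> k)\<close> and \<open>\<sigma> k\<close>
  agree the two lifts cancel.\<close>

lemma shifted_y_near:
  assumes q: "\<And>k. (\<lambda>j. q (k, j)) \<in> null_seqs" and r: "\<And>p. cmod (q p) \<le> r"
    and agree: "\<And>k. k < m \<Longrightarrow> \<pi> (\<tau> k) = \<sigma> k" and F: "finite F"
  shows "(\<Sum>p\<in>F. cmod (shifted_y \<sigma> \<tau> \<pi> y q p - y p)) \<le> 16 * r / 2 ^ m"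
proof -
  have r0: "0 \<le> r" using norm_ge_zero r by (rule order_trans)
  obtain N where N: "F \<subseteq> {..<N} \<times> {..<N}"
  proof -
    obtain N where "\<forall>x\<in>fst ` F \<union> snd ` F. x < N" using F finite_nat_set_iff_bounded by (metis finite_UnI finite_imageI)
    then show thesis by (intro that[of N]) force
  qed
  let ?d = "\<lambda>p. cmod (shifted_y \<sigma> \<tau> \<pi> y q p - y p)"
  have "(\<Sum>p\<in>F. ?d p) \<le> (\<Sum>p\<in>{..<N} \<times> {..<N}. ?d p)" using N by (intro sum_mono2) auto
  also have "\<dots> = (\<Sum>k<N. \<Sum>a<N. ?d (k, a))" by (simp add: sum.cartesian_product)
  also have "\<dots> \<le> (\<Sum>k<N. 8 * r * (if k < m then 0 else 1 / 2 ^ k))"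
  proof (rule sum_mono)
    fix k
    show "(\<Sum>a<N. ?d (k, a)) \<le> 8 * r * (if k < m then 0 else 1 / 2 ^ k)"
    proof (cases "k < m")
      case True
      then show ?thesis using agree by (simp add: shifted_y_def)
    next
      case False
      let ?s = "lift_null_seq (\<lambda>j. q (\<pi> (\<tau> k), j))" and ?s' = "lift_null_seq (\<lambda>j. q (\<sigma> k, j))"
      have "(\<Sum>a<N. ?d (k, a)) \<le> (\<Sum>a<N. (cmod (?s a) + cmod (?s' a)) / 2 ^ k)"
        by (intro sum_mono) (simp add: shifted_y_def norm_divide norm_power divide_right_mono norm_triangle_ineq4)
      also have "\<dots> = ((\<Sum>a<N. cmod (?s a)) + (\<Sum>a<N. cmod (?s' a))) / 2 ^ k"
        by (simp flip: sum_divide_distrib sum.distrib)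
      also have "\<dots> \<le> (4 * r + 4 * r) / 2 ^ k"
        using r by (intro divide_right_mono add_mono lift_null_seq(1) q) auto
      finally show ?thesis using False by simp
    qed
  qed
  also have "\<dots> = 8 * r * (\<Sum>k<N. if k < m then 0 else 1 / 2 ^ k)" by (simp add: sum_distrib_left)
  also have "\<dots> \<le> 8 * r * (2 / 2 ^ m)" using r0 by (intro mult_left_mono geometric_tail_le) auto
  finally show ?thesis by simp
qed

text \<open>The odd positions are permuted without any error; the even ones are fixed up to the
  change in \<open>y\<close>.\<close>

lemma coords_shift_near:
  assumes q: "\<And>k. (\<lambda>j. q (k, j)) \<in> null_seqs" and r: "\<And>p. cmod (q p) \<le> r" and "inj \<pi>"
    and agree: "\<And>k. k < m \<Longrightarrow> \<pi> (\<tau> k) = \<sigma> k"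
  shows "cmod (coords (shifted_y \<sigma> \<tau> \<pi> y q) (shifted_q \<pi> q) t - coords y q (shift_index \<pi> t)) \<le> 16 * r / 2 ^ m"
proof (cases "even t")
  case True
  let ?F = "pair_set (t div 2)"
  have "cmod (sum (shifted_y \<sigma> \<tau> \<pi> y q) ?F - sum y ?F) \<le> (\<Sum>p\<in>?F. cmod (shifted_y \<sigma> \<tau> \<pi> y q p - y p))"
    unfolding sum_subtractf[symmetric] by (rule norm_sum)
  also have "\<dots> \<le> 16 * r / 2 ^ m" by (intro shifted_y_near q r agree finite_pair_set)
  finally show ?thesis using True by (simp add: coords_def shift_index_def)
next
  case False
  let ?G = "pair_set (t div 2)"
  have "0 \<le> r" using norm_ge_zero r by (rule order_trans)
  have "inj_on (map_prod \<pi> id) ?G" using \<open>inj \<pi>\<close> by (auto simp: inj_on_def)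
  then have "sum q (map_prod \<pi> id ` ?G) = sum (shifted_q \<pi> q) ?G"
    by (subst sum.reindex) (auto simp: shifted_q_def intro!: sum.cong)
  then have "coords (shifted_y \<sigma> \<tau> \<pi> y q) (shifted_q \<pi> q) t = coords y q (shift_index \<pi> t)"
    using False by (simp add: coords_def shift_index_def q_index_def single_valued_map_fst[OF \<open>inj \<pi>\<close>])
  then show ?thesis using \<open>0 \<le> r\<close> by simp
qed

lemma admissible_shift:
  assumes "admissible \<sigma> y q" "inj \<pi>"
  shows "admissible \<tau> (shifted_y \<sigma> \<tau> \<pi> y q) (shifted_q \<pi> q)"
  unfolding admissible_def
proof (intro conjI allI)
  have null: "(\<lambda>j. q (k, j)) \<in> null_seqs" for k using assms by (simp add: admissible_def)
  obtain r where r: "\<And>t. cmod (coords y q t) \<le> r" using assms by (auto simp: admissible_def bounded_seqs_def)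
  \<comment> \<open>The case \<open>m = 0\<close> of the estimate bounds the change in all rows together.\<close>
  have "cmod (coords (shifted_y \<sigma> \<tau> \<pi> y q) (shifted_q \<pi> q) t) \<le> 16 * r + r" for t
    using coords_shift_near[of q r \<pi> 0 \<tau> \<sigma> y t, OF null entry_q_le[OF r] assms(2)] r[of "shift_index \<pi> t"]
      norm_triangle_sub[of "coords (shifted_y \<sigma> \<tau> \<pi> y q) (shifted_q \<pi> q) t" "coords y q (shift_index \<pi> t)"]
    by simp
  then show "coords (shifted_y \<sigma> \<tau> \<pi> y q) (shifted_q \<pi> q) \<in> bounded_seqs"
    unfolding bounded_seqs_def by blast
  show "(\<lambda>j. shifted_q \<pi> q (k, j)) \<in> null_seqs" for k using null by (simp add: shifted_q_def)
  show "((\<lambda>a. shifted_y \<sigma> \<tau> \<pi> y q (k, a)) has_sum (shifted_q \<pi> q (\<tau> k, j) / 2 ^ k)) {a. j \<in> set_decode a}" for k j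
  proof -
    have "((\<lambda>a. y (k, a) + (lift_null_seq (\<lambda>j. q (\<pi> (\<tau> k), j)) a + (-1) * lift_null_seq (\<lambda>j. q (\<sigma> k, j)) a) * (1 / 2 ^ k))
       has_sum (q (\<sigma> k, j) / 2 ^ k + (q (\<pi> (\<tau> k), j) + (-1) * q (\<sigma> k, j)) * (1 / 2 ^ k))) {a. j \<in> set_decode a}"
      using assms(1) by (intro has_sum_add has_sum_cmult_left has_sum_cmult_right lift_null_seq(2) null) (auto simp: admissible_def)
    then show ?thesis by (simp add: shifted_y_def shifted_q_def algebra_simps diff_divide_distrib add_divide_distrib)
  qed
qed

lemma shift_in_coord_space: "shift \<sigma> \<tau> \<pi> v \<in> coord_space \<tau>" if "v \<in> coord_space \<sigma>" "inj \<pi>"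
  unfolding shift_def coord_space_def using admissible_shift[OF coord_space_parts(1)] that by blast

lemma shift_inverse:
  assumes v: "v \<in> coord_space \<sigma>" and p: "\<And>k. \<pi> (\<pi>' k) = k"
  shows "shift \<tau> \<sigma> \<pi>' (shift \<sigma> \<tau> \<pi> v) = v"
proof -
  have "shifted_q \<pi>' (shifted_q \<pi> q) = q" for q using p by (auto simp: shifted_q_def)
  moreover have "shifted_y \<tau> \<sigma> \<pi>' (shifted_y \<sigma> \<tau> \<pi> y q) (shifted_q \<pi> q) = y" for y q
    using p by (auto simp: shifted_y_def shifted_q_def field_simps)
  ultimately show ?thesis using coord_space_parts(2)[OF v] by (simp add: shift_def)
qed

lemma shift_near:
  assumes v: "v \<in> coord_space \<sigma>" and r: "\<And>t. cmod (v t) \<le> r" and "inj \<pi>"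
    and agree: "\<And>k. k < m \<Longrightarrow> \<pi> (\<tau> k) = \<sigma> k"
  shows "cmod (shift \<sigma> \<tau> \<pi> v t - v (shift_index \<pi> t)) \<le> 16 * r / 2 ^ m"
proof -
  note a = coord_space_parts[OF v]
  have null: "(\<lambda>j. q_part v (k, j)) \<in> null_seqs" for k using a(1) by (simp add: admissible_def)
  have "cmod (q_part v p) \<le> r" for p using r by (simp add: q_part_def)
  then show ?thesis
    using coords_shift_near[of "q_part v" r \<pi> m \<tau> \<sigma> "y_part v" t, OF null _ assms(3) agree] a(2)
    by (simp add: shift_def)
qed

definition diag_seq :: "((nat \<Rightarrow> complex) \<Rightarrow> nat \<Rightarrow> complex) \<Rightarrow> nat \<Rightarrow> complex" where
  "diag_seq T = (\<lambda>t. T (unit_seq t) t)"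

lemma diag_seq_diag [simp]: "diag_seq (diag a) = a"
  by (simp add: diag_seq_def)

text \<open>The hypotheses are symmetric under exchanging \<open>\<sigma>\<close> with
  \<open>\<tau>\<close> and \<open>\<pi> n\<close> with its inverse, so one estimate serves both
  directions.\<close>

lemma bounded_equivalence_of_permutations:
  assumes bij: "\<And>n. bij (\<pi> n)" and agree: "\<And>n k. k < 3 * n + 4 \<Longrightarrow> \<pi> n (\<tau> k) = \<sigma> k"
  shows "bounded_almost_completely_coarsely_equivalent ell2 (diag ` coord_space \<sigma>) ell2 (diag ` coord_space \<tau>)"
proof -
  define \<iota> where "\<iota> = (\<lambda>n. inv_into UNIV (\<pi> n))"
  have pi: "\<pi> n (\<iota> n k) = k" for n k using bij by (simp add: \<iota>_def bij_is_surj surj_f_inv_f)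
  have ip: "\<iota> n (\<pi> n k) = k" for n k using bij by (simp add: \<iota>_def bij_is_inj)
  have bij': "bij (\<iota> n)" for n using bij by (simp add: \<iota>_def bij_imp_bij_inv)
  have agree': "\<iota> n (\<sigma> k) = \<tau> k" if "k < 3 * n + 4" for n k using agree[OF that] ip by metis
  note inj = bij_is_inj[OF bij] and inj' = bij_is_inj[OF bij']
  \<comment> \<open>This is where the length \<open>3 n + 4\<close> comes from: \<open>16 n\<^sup>3 \<le> 2\<^sup>4 (2\<^sup>n)\<^sup>3\<close>.\<close>
  have small: "16 * real n / 2 ^ (3 * n + 4) \<le> 1 / (real n)\<^sup>2" if "n \<ge> 1" for n
  proof -
    have "real n ^ 3 \<le> (2 ^ n) ^ 3" using of_nat_less_two_power[of n] by (intro power_mono) (auto intro: less_imp_le)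
    then have "real n ^ 3 \<le> 2 ^ (3 * n)" by (simp add: power_mult mult.commute)
    then show ?thesis using that by (simp add: field_simps power_add power2_eq_square power3_eq_cube)
  qed
  define f where "f = (\<lambda>n T. diag (shift \<sigma> \<tau> (\<pi> n) (diag_seq T)))"
  have f: "bij_betw (f n) (diag ` coord_space \<sigma>) (diag ` coord_space \<tau>)" for n
    by (rule bij_betwI[where g = "\<lambda>T. diag (shift \<tau> \<sigma> (\<iota> n) (diag_seq T))"])
      (auto simp: f_def inj inj' shift_in_coord_space shift_inverse[where \<pi> = "\<pi> n" and \<pi>' = "\<iota> n"]
        shift_inverse[where \<pi> = "\<iota> n" and \<pi>' = "\<pi> n"] pi ip)
  have g: "inv_into (diag ` coord_space \<sigma>) (f n) (diag b) = diag (shift \<tau> \<sigma> (\<iota> n) b)" if "b \<in> coord_space \<tau>" for n b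
    using that inj' shift_inverse[OF that, of "\<iota> n" "\<pi> n"] ip
    by (intro inv_into_f_eq[OF bij_betw_imp_inj_on[OF f]]) (auto simp: f_def shift_in_coord_space)
  show ?thesis
    unfolding bounded_almost_completely_coarsely_equivalent_def
  proof (intro exI[of _ f] conjI allI impI f)
    show "equi_coarse_embedding {1..}
      (\<lambda>n. mat_ball ell2 (diag ` coord_space \<sigma>) n (real n)) (\<lambda>n. mat_op_dist ell2)
      (\<lambda>n. matrices_over n (diag ` coord_space \<tau>)) (\<lambda>n. mat_op_dist ell2) (\<lambda>n. map_mat (f n))"
    proof (rule equi_coarse_embedding_diag[where h = "\<lambda>n. shift \<sigma> \<tau> (\<pi> n)" and r = "\<lambda>n. shift_index (\<pi> n)"])
      fix n a t assume n: "1 \<le> n" and a: "a \<in> coord_space \<sigma>" "\<forall>i. cmod (a i) \<le> real n"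
      have "cmod (shift \<sigma> \<tau> (\<pi> n) a t - a (shift_index (\<pi> n) t)) \<le> 16 * real n / 2 ^ (3 * n + 4)"
        using a by (intro shift_near inj agree) auto
      with small[OF n] show "cmod (shift \<sigma> \<tau> (\<pi> n) a t - a (shift_index (\<pi> n) t)) \<le> 1 / (real n)\<^sup>2" by linarith
    qed (auto simp: f_def inj shift_in_coord_space coord_space_bounded[THEN subsetD] surj_shift_index[OF bij])
    show "equi_coarse_embedding {1..}
      (\<lambda>n. mat_ball ell2 (diag ` coord_space \<tau>) n (real n)) (\<lambda>n. mat_op_dist ell2)
      (\<lambda>n. matrices_over n (diag ` coord_space \<sigma>)) (\<lambda>n. mat_op_dist ell2)
      (\<lambda>n. map_mat (inv_into (diag ` coord_space \<sigma>) (f n)))"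
    proof (rule equi_coarse_embedding_diag[where h = "\<lambda>n. shift \<tau> \<sigma> (\<iota> n)" and r = "\<lambda>n. shift_index (\<iota> n)"])
      fix n a t assume n: "1 \<le> n" and a: "a \<in> coord_space \<tau>" "\<forall>i. cmod (a i) \<le> real n"
      have "cmod (shift \<tau> \<sigma> (\<iota> n) a t - a (shift_index (\<iota> n) t)) \<le> 16 * real n / 2 ^ (3 * n + 4)"
        using a by (intro shift_near inj' agree') auto
      with small[OF n] show "cmod (shift \<tau> \<sigma> (\<iota> n) a t - a (shift_index (\<iota> n) t)) \<le> 1 / (real n)\<^sup>2" by linarith
    qed (auto simp: g inj' shift_in_coord_space coord_space_bounded[THEN subsetD] surj_shift_index[OF bij'])
  qed
qed

text \<open>The permutation is the cycle that moves the free row \<open>0\<close> to slot \<open>3 n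
  + 4\<close> and rows \<open>1, \<dots>, 3 n + 4\<close> down by one.\<close>

lemma bounded_equivalence_Suc_id:
  "bounded_almost_completely_coarsely_equivalent ell2 (diag ` coord_space Suc) ell2 (diag ` coord_space id)"
proof (rule bounded_equivalence_of_permutations)
  let ?p = "\<lambda>n k :: nat. if k < 3 * n + 4 then Suc k else if k = 3 * n + 4 then 0 else k"
  show "bij (?p n)" for n
    by (rule o_bij[where g = "\<lambda>k. if k = 0 then 3 * n + 4 else if k \<le> 3 * n + 4 then k - 1 else k"])
      (auto simp: fun_eq_iff)
  show "?p n (id k) = Suc k" if "k < 3 * n + 4" for n k using that by simp
qed

section \<open>Non-embedding\<close>

lemma coords_sum:
  "(\<Sum>i\<in>I. c i * coords (y i) (q i) t) = coords (\<lambda>p. \<Sum>i\<in>I. c i * y i p) (\<lambda>p. \<Sum>i\<in>I. c i * q i p) t"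
  by (auto simp: coords_def sum_distrib_left intro: sum.swap)

text \<open>In terms of norms: if all combinations with coefficients of modulus at most one are
  bounded in \<open>l\<^sub>1\<close>, then so is the pointwise supremum.\<close>

lemma sum_selection_le:
  fixes a :: "nat \<Rightarrow> 't \<Rightarrow> complex"
  assumes bd: "\<And>n c. (\<And>i. cmod (c i) \<le> 1) \<Longrightarrow> (\<Sum>t\<in>T. cmod (\<Sum>i<n. c i * a i t)) \<le> C" and T: "finite T"
  shows "(\<Sum>t\<in>T. cmod (a (i t) t)) \<le> C"
proof -
  \<comment> \<open>Beyond all selected indices, so that the first alternative of the sign lemma applies at every \<open>t\<close>.\<close>
  obtain n where n: "\<forall>k\<in>i ` T. k < n" using T finite_nat_set_iff_bounded by (metis finite_imageI)
  obtain c :: "nat \<Rightarrow> complex" where c: "\<forall>i. c i = 1 \<or> c i = -1"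
    "(\<Sum>t\<in>T. if i t < n then cmod (a (i t) t) else cmod 0) \<le> (\<Sum>t\<in>T. cmod (0 + (\<Sum>i<n. c i * a i t)))"
    using exists_signs_sum_ge_selection[OF T, where s = "\<lambda>_. 0" and i = i and n = n and a = a] by blast
  have "cmod (c i) \<le> 1" for i using c(1)[rule_format, of i] by auto
  from bd[where c = c and n = n, OF this] c(2) n show ?thesis by (simp cong: sum.cong_simp)
qed

lemma norm_has_sum_le:
  fixes f :: "'a \<Rightarrow> complex"
  assumes "(f has_sum s) A" "\<And>F. finite F \<Longrightarrow> F \<subseteq> A \<Longrightarrow> cmod (sum f F) \<le> e"
  shows "cmod s \<le> e"
proof (rule Lim_norm_ubound)
  show "(sum f \<longlongrightarrow> s) (finite_subsets_at_top A)" using assms(1) by (simp add: has_sum_def)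
  show "eventually (\<lambda>F. cmod (sum f F) \<le> e) (finite_subsets_at_top A)"
    using assms(2) by (intro eventually_finite_subsets_at_top_weakI) auto
qed simp

text \<open>The space contains no copy of \<open>c\<^sub>0\<close>, proved by dominated convergence,
  twice. The pointwise supremum of the \<open>y\<close>-parts is summable and each entry tends to
  zero, so the \<open>y\<close>-parts tend to zero in \<open>l\<^sub>1\<close>. As
  \<open>\<sigma>\<close> is the identity, every row of the \<open>q\<close>-parts is
  \<open>2^k\<close> times the quotient image of a row of the \<open>y\<close>-parts, so every row
  tends to zero uniformly; the suprema of the rows are dominated by a summable sequence as well.\<close>

lemma bounded_multipliers_tendsto_0:
  fixes v :: "nat \<Rightarrow> nat \<Rightarrow> complex"
  assumes v: "\<And>i. v i \<in> coord_space id"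
    and bd: "\<And>n c t. (\<And>i. cmod (c i) \<le> 1) \<Longrightarrow> cmod (\<Sum>i<n. c i * v i t) \<le> r"
    and "e > 0"
  shows "eventually (\<lambda>i. \<forall>t. cmod (v i t) \<le> e) sequentially"
proof -
  define y where "y = (\<lambda>i. y_part (v i))"
  define q where "q = (\<lambda>i. q_part (v i))"
  have adm: "admissible id (y i) (q i)" and vi: "v i = coords (y i) (q i)" for i
    using coord_space_parts[OF v[of i]] by (simp_all add: y_def q_def)
  have comb: "cmod (coords (\<lambda>p. \<Sum>i<n. c i * y i p) (\<lambda>p. \<Sum>i<n. c i * q i p) t) \<le> r"
    if "\<And>i. cmod (c i) \<le> 1" for c n t
    using bd[where c = c and n = n and t = t, OF that] by (simp add: vi coords_sum)
  have ysel: "(\<Sum>p\<in>F. cmod (y (i p) p)) \<le> 4 * r" if "finite F" for F i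
    by (rule sum_selection_le[OF _ that]) (rule sum_abs_y_le[OF comb that])
  have qsel: "(\<Sum>k\<in>K. cmod (q (fst (i k)) (k, snd (i k)))) \<le> 4 * r" if K: "finite K" for K i
  proof -
    have "(\<Sum>k\<in>K. cmod (\<Sum>m<n. c m * q m (k, snd (i k)))) \<le> 4 * r"
      if "\<And>m. cmod (c m) \<le> 1" for c n
      using sum_abs_q_le[OF comb[where c = c and n = n, OF that] finite_imageI[OF K] single_valued_graph, where i1 = "\<lambda>k. snd (i k)"]
      by (simp add: sum_graph)
    then show ?thesis
      by (rule sum_selection_le[where a = "\<lambda>m k. q m (k, snd (i k))" and i = "\<lambda>k. fst (i k)", OF _ K])
  qed
  have y0: "(\<lambda>i. y i p) \<longlonglongrightarrow> 0" for p
  proof -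
    have "(\<Sum>i<n. cmod (y i p)) \<le> 2 * real DIM(complex) * r" for n
    proof (rule sum_norm_allsubsets_bound)
      fix Q assume Q: "Q \<subseteq> {..<n}"
      have "cmod (\<Sum>i<n. (if i \<in> Q then 1 else 0) * y i p) \<le> r"
        using sum_y_le[OF comb[of "\<lambda>i. if i \<in> Q then 1 else 0" n], of "{p}"] by simp
      also have "(\<Sum>i<n. (if i \<in> Q then 1 else 0) * y i p) = (\<Sum>i\<in>Q. y i p)"
        using Q by (intro sum.mono_neutral_cong_right) auto
      finally show "cmod (\<Sum>i\<in>Q. y i p) \<le> r" .
    qed simp
    then have "summable (\<lambda>i. cmod (y i p))" by (intro summableI_nonneg_bounded) auto
    then show ?thesis using summable_LIMSEQ_zero tendsto_norm_zero_iff by blast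
  qed
  have y_small: "eventually (\<lambda>i. \<forall>F. finite F \<longrightarrow> (\<Sum>p\<in>F. cmod (y i p)) \<le> d) sequentially" if "d > 0" for d
  proof -
    obtain P where P: "finite P" "\<And>F i. finite F \<Longrightarrow> F \<inter> P = {} \<Longrightarrow> (\<Sum>p\<in>F. cmod (y (i p) p)) \<le> d / 2"
      using selection_sums_uniform_tail[of y "4 * r" "d / 2"] ysel \<open>d > 0\<close> by auto
    have "(\<lambda>i. \<Sum>p\<in>P. cmod (y i p)) \<longlonglongrightarrow> (\<Sum>p\<in>P. cmod 0)"
      by (intro tendsto_sum tendsto_norm y0)
    then have "eventually (\<lambda>i. (\<Sum>p\<in>P. cmod (y i p)) < d / 2) sequentially"
      using that by (intro order_tendstoD(2)) auto
    then show ?thesis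
    proof eventually_elim
      case (elim i)
      show ?case
      proof (intro allI impI)
        fix F :: "(nat \<times> nat) set" assume F: "finite F"
        have "(\<Sum>p\<in>F. cmod (y i p)) = (\<Sum>p\<in>F \<inter> P. cmod (y i p)) + (\<Sum>p\<in>F - P. cmod (y i p))"
          using F by (subst sum.union_disjoint[symmetric]) (auto simp: Int_Diff_Un)
        also have "\<dots> \<le> (\<Sum>p\<in>P. cmod (y i p)) + d / 2"
          using F P(1) by (intro add_mono sum_mono2 P(2)[of "F - P" "\<lambda>_. i"]) auto
        finally show "(\<Sum>p\<in>F. cmod (y i p)) \<le> d" using elim by linarith
      qed
    qed
  qed
  have q_row_small: "eventually (\<lambda>i. \<forall>j. cmod (q i (k, j)) \<le> d) sequentially" if "d > 0" for k d
  proof -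
    have "d / 2 ^ k > 0" using that by simp
    from y_small[OF this] show ?thesis
    proof eventually_elim
      case (elim i)
      show ?case
      proof
        fix j
        have "cmod (q i (k, j) / 2 ^ k) \<le> d / 2 ^ k"
        proof (rule norm_has_sum_le)
          show "((\<lambda>a. y i (k, a)) has_sum (q i (k, j) / 2 ^ k)) {a. j \<in> set_decode a}"
            using adm[of i] by (simp add: admissible_def)
          fix F :: "nat set" assume F: "finite F"
          have "cmod (\<Sum>a\<in>F. y i (k, a)) \<le> (\<Sum>p\<in>{k} \<times> F. cmod (y i p))"
            unfolding sum_row[symmetric] by (rule norm_sum)
          also have "\<dots> \<le> d / 2 ^ k" using F by (intro elim[rule_format]) simp
          finally show "cmod (\<Sum>a\<in>F. y i (k, a)) \<le> d / 2 ^ k" .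
        qed
        then show "cmod (q i (k, j)) \<le> d" by (simp add: norm_divide norm_power divide_le_cancel)
      qed
    qed
  qed
  obtain K where K: "finite K"
    "\<And>F i. finite F \<Longrightarrow> F \<inter> K = {} \<Longrightarrow> (\<Sum>k\<in>F. cmod (q (fst (i k)) (k, snd (i k)))) \<le> e / 2"
    using selection_sums_uniform_tail[of "\<lambda>s k. q (fst s) (k, snd s)" "4 * r" "e / 2"] qsel \<open>e > 0\<close> by auto
  define \<delta> where "\<delta> = e / (2 * (card K + 1))"
  have "\<delta> > 0" using \<open>e > 0\<close> by (simp add: \<delta>_def)
  have "eventually (\<lambda>i. \<forall>k\<in>K. \<forall>j. cmod (q i (k, j)) \<le> \<delta>) sequentially"
    using K(1) q_row_small[OF \<open>\<delta> > 0\<close>] by (simp add: eventually_ball_finite)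
  with y_small[OF \<open>e > 0\<close>] show ?thesis
  proof eventually_elim
    case (elim i)
    show ?case
      unfolding vi
    proof (intro allI coords_le)
      show "cmod (sum (y i) F) \<le> e" if "finite F" for F
        using norm_sum[of "y i" F] elim(1) that by (meson order_trans)
      fix G :: "(nat \<times> nat) set" assume G: "finite G" "single_valued G"
      obtain s where s: "G = (\<lambda>k. (k, s k)) ` fst ` G" using single_valued_obtain_graph[OF G(2)] .
      define L where "L = fst ` G"
      have L: "finite L" using G by (simp add: L_def)
      have "cmod (sum (q i) G) \<le> (\<Sum>p\<in>G. cmod (q i p))" by (rule norm_sum)
      also have "\<dots> = (\<Sum>k\<in>L. cmod (q i (k, s k)))"
        unfolding L_def by (subst s) (rule sum_graph)
      also have "\<dots> = (\<Sum>k\<in>L \<inter> K. cmod (q i (k, s k))) + (\<Sum>k\<in>L - K. cmod (q i (k, s k)))"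
        using L by (subst sum.union_disjoint[symmetric]) (auto simp: Int_Diff_Un)
      also have "\<dots> \<le> (\<Sum>k\<in>L \<inter> K. \<delta>) + e / 2"
        using L elim(2) K(2)[of "L - K" "\<lambda>k. (i, s k)"] by (intro add_mono sum_mono) auto
      also have "\<dots> \<le> (\<Sum>k\<in>K. \<delta>) + e / 2"
        using L K \<open>\<delta> > 0\<close> by (intro add_mono sum_mono2) auto
      also have "\<dots> \<le> e" using \<open>e > 0\<close> by (simp add: \<delta>_def field_simps)
      finally show "cmod (sum (q i) G) \<le> e" .
    qed
  qed
qed

text \<open>Coefficients \<open>c 0, \<dots>, c (n - 1)\<close> placed in the row of
  \<open>q\<close> that \<open>Suc\<close> misses.\<close>

definition c0_vector :: "(nat \<Rightarrow> complex) \<Rightarrow> nat \<Rightarrow> nat \<Rightarrow> complex" where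
  "c0_vector c n = coords (\<lambda>_. 0) (\<lambda>p. if fst p = 0 \<and> snd p < n then c (snd p) else 0)"

text \<open>A finite partial function meets row \<open>0\<close> in at most one entry, which is why
  this row carries the supremum norm.\<close>

lemma c0_vector_bound:
  assumes "\<And>j. cmod (c j) \<le> b"
  shows "cmod (c0_vector c n t) \<le> b"
  unfolding c0_vector_def
proof (rule coords_le)
  have b: "0 \<le> b" using norm_ge_zero assms by (rule order_trans)
  then show "cmod (\<Sum>_\<in>F. 0) \<le> b" for F :: "(nat \<times> nat) set" by simp
  fix G :: "(nat \<times> nat) set" assume G: "finite G" "single_valued G"
  obtain s where s: "G = (\<lambda>k. (k, s k)) ` fst ` G" using single_valued_obtain_graph[OF G(2)] .
  define L where "L = fst ` G"
  have "(\<Sum>p\<in>G. if fst p = 0 \<and> snd p < n then c (snd p) else 0)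
     = (\<Sum>k\<in>L. if k = 0 \<and> s k < n then c (s k) else 0)"
    unfolding L_def by (subst s) (simp only: sum_graph fst_conv snd_conv)
  also have "\<dots> = (\<Sum>k\<in>L. if k = 0 then (if s 0 < n then c (s 0) else 0) else 0)"
    by (rule sum.cong) simp_all
  also have "\<dots> = (if 0 \<in> L then (if s 0 < n then c (s 0) else 0) else 0)"
    using G(1) by (subst sum.delta) (auto simp: L_def)
  finally show "cmod (\<Sum>p\<in>G. if fst p = 0 \<and> snd p < n then c (snd p) else 0) \<le> b"
    using assms b by simp
qed

lemma c0_vector_in_coord_space:
  assumes b: "\<And>j. cmod (c j) \<le> b"
  shows "c0_vector c n \<in> coord_space Suc"
proof -
  have "(\<lambda>j. if k = 0 \<and> j < n then c j else 0) \<longlonglongrightarrow> 0" for k :: nat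
    by (rule tendsto_eventually) (auto simp: eventually_sequentially intro!: exI[of _ n])
  then have "admissible Suc (\<lambda>_. 0) (\<lambda>p. if fst p = 0 \<and> snd p < n then c (snd p) else 0)"
    using c0_vector_bound[where c = c and b = b and n = n, OF b]
    by (auto simp: admissible_def c0_vector_def bounded_seqs_def null_seqs_def intro: has_sum_0 cong: if_cong)
  then show ?thesis unfolding c0_vector_def coord_space_def by blast
qed

definition c0_unit :: "nat \<Rightarrow> nat \<Rightarrow> complex" where
  "c0_unit i = c0_vector (\<lambda>j. if j = i then 1 else 0) (Suc i)"

lemma c0_unit_in_coord_space: "c0_unit i \<in> coord_space Suc"
  unfolding c0_unit_def by (rule c0_vector_in_coord_space[of _ 1]) simp

lemma c0_vector_Suc: "c0_vector c (Suc n) = c0_vector c n + (\<lambda>t. c n * c0_unit n t)"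
  unfolding c0_unit_def c0_vector_def coords_scale coords_add
  by (intro arg_cong2[where f = coords] ext) (auto simp: less_Suc_eq)

lemma c0_vector_0: "c0_vector c 0 = (\<lambda>t. 0 * c0_unit 0 t)"
  by (auto simp: c0_vector_def coords_def)

lemma op_norm_c0_unit: "1 \<le> op_norm ell2 (diag (c0_unit i))"
proof -
  have "cmod (c0_unit i (q_index {(0, i)})) \<le> op_norm ell2 (diag (c0_unit i))"
    using c0_unit_in_coord_space coord_space_bounded by (intro coord_le_op_norm_diag) blast
  then show ?thesis by (simp add: c0_unit_def c0_vector_def)
qed

text \<open>The images of the unit vectors of \<open>c\<^sub>0\<close> would tend to zero in norm
  although the embedding is bounded below.\<close>

lemma not_isomorphically_embeds_coord_space:
  "\<not> isomorphically_embeds ell2 (diag ` coord_space Suc) ell2 (diag ` coord_space id)"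
proof
  let ?X = "diag ` coord_space Suc" and ?Y = "diag ` coord_space id"
  assume "isomorphically_embeds ell2 ?X ell2 ?Y"
  then obtain u where u: "bounded_linear_between ell2 ?X ell2 ?Y u" "inj_on u ?X"
    and u': "bounded_linear_between ell2 (u ` ?X) ell2 ?X (inv_into ?X u)"
    unfolding isomorphically_embeds_def by blast
  have uY: "u S \<in> ?Y" and uadd: "T \<in> ?X \<Longrightarrow> u (S + T) = u S + u T"
    and uscale: "u (op_scale ell2 c S) = op_scale ell2 c (u S)" if "S \<in> ?X" for S T c
    using u(1) that unfolding bounded_linear_between_def by blast+
  obtain C where C: "\<And>S. S \<in> ?X \<Longrightarrow> op_norm ell2 (u S) \<le> C * op_norm ell2 S"
  proof -
    have "\<exists>C. \<forall>S\<in>?X. op_norm ell2 (u S) \<le> C * op_norm ell2 S"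
      using u(1) unfolding bounded_linear_between_def by (elim conjE)
    then show thesis using that by blast
  qed
  obtain C' where C': "\<And>S. S \<in> ?X \<Longrightarrow> op_norm ell2 S \<le> C' * op_norm ell2 (u S)"
  proof -
    have "\<exists>D. \<forall>T\<in>u ` ?X. op_norm ell2 (inv_into ?X u T) \<le> D * op_norm ell2 T"
      using u' unfolding bounded_linear_between_def by (elim conjE)
    then obtain D where D: "\<And>T. T \<in> u ` ?X \<Longrightarrow> op_norm ell2 (inv_into ?X u T) \<le> D * op_norm ell2 T"
      by metis
    have "op_norm ell2 S \<le> D * op_norm ell2 (u S)" if "S \<in> ?X" for S
      using D[OF imageI[OF that]] inv_into_f_f[OF u(2) that] by simp
    then show thesis by (rule that)
  qed
  define v where "v = (\<lambda>i. diag_seq (u (diag (c0_unit i))))"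
  have unit: "diag (c0_unit i) \<in> ?X" for i using c0_unit_in_coord_space by blast
  have v: "v i \<in> coord_space id" "u (diag (c0_unit i)) = diag (v i)" for i
    using uY[OF unit[of i]] by (auto simp: v_def)
  have uc: "u (diag (c0_vector c n)) = diag (\<lambda>t. \<Sum>i<n. c i * v i t)" if b: "\<And>j. cmod (c j) \<le> 1" for c n
  proof (induction n)
    case 0
    show ?case unfolding c0_vector_0 diag_scale[symmetric] uscale[OF unit] v(2)
      by (simp add: diag_scale)
  next
    case (Suc n)
    have "(\<lambda>t. c n * c0_unit n t) \<in> coord_space Suc"
      by (rule coord_space_scale[OF c0_unit_in_coord_space])
    then have "u (diag (c0_vector c (Suc n))) = u (diag (c0_vector c n)) + u (diag (\<lambda>t. c n * c0_unit n t))"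
      unfolding c0_vector_Suc diag_add[symmetric] using c0_vector_in_coord_space[where c = c, OF b] by (intro uadd) auto
    also have "\<dots> = diag (\<lambda>t. \<Sum>i<n. c i * v i t) + diag (\<lambda>t. c n * v n t)"
      unfolding Suc.IH diag_scale[symmetric] uscale[OF unit] v(2) by simp
    also have "\<dots> = diag (\<lambda>t. \<Sum>i<Suc n. c i * v i t)" unfolding diag_add by (intro arg_cong[where f = diag] ext) simp
    finally show ?case .
  qed
  have bd: "cmod (\<Sum>i<n. c i * v i t) \<le> \<bar>C\<bar>" if b: "\<And>i. cmod (c i) \<le> 1" for n c t
  proof -
    have X: "diag (c0_vector c n) \<in> ?X" using c0_vector_in_coord_space[where c = c, OF b] by blast
    have "(\<lambda>t. \<Sum>i<n. c i * v i t) \<in> coord_space id"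
      using uY[OF X] unfolding uc[where c = c, OF b] by auto
    then have "cmod (\<Sum>i<n. c i * v i t) \<le> op_norm ell2 (diag (\<lambda>t. \<Sum>i<n. c i * v i t))"
      using coord_le_op_norm_diag[of "\<lambda>t. \<Sum>i<n. c i * v i t" t] coord_space_bounded by blast
    also have "\<dots> \<le> C * op_norm ell2 (diag (c0_vector c n))" using C[OF X] unfolding uc[where c = c, OF b] .
    also have "\<dots> \<le> \<bar>C\<bar> * 1"
    proof (rule mult_mono)
      show "op_norm ell2 (diag (c0_vector c n)) \<le> 1"
        by (intro op_norm_diag_le c0_vector_bound b)
      show "0 \<le> op_norm ell2 (diag (c0_vector c n))"
        by (intro op_norm_nonneg diag_bounded_ops subsetD[OF coord_space_bounded[of Suc]]
            c0_vector_in_coord_space[where c = c, OF b])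
    qed auto
    finally show ?thesis by simp
  qed
  \<comment> \<open>Small enough to contradict the lower bound \<open>1 \<le> C' * e\<close>.\<close>
  define e where "e = 1 / (2 * (\<bar>C'\<bar> + 1))"
  have "e > 0" by (simp add: e_def)
  obtain i where i: "\<forall>t. cmod (v i t) \<le> e"
    using bounded_multipliers_tendsto_0[OF v(1) bd \<open>e > 0\<close>] by (auto simp: eventually_sequentially)
  have "1 \<le> C' * op_norm ell2 (diag (v i))"
    using op_norm_c0_unit C'[OF unit[of i]] v(2)[of i] by (metis order_trans)
  also have "\<dots> \<le> \<bar>C'\<bar> * e"
  proof (rule mult_mono)
    show "op_norm ell2 (diag (v i)) \<le> e" using i by (intro op_norm_diag_le) blast
    show "0 \<le> op_norm ell2 (diag (v i))"
      by (intro op_norm_nonneg diag_bounded_ops subsetD[OF coord_space_bounded[of id]] v(1))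
  qed auto
  also have "\<dots> < 1" unfolding e_def by (simp add: field_simps)
  finally show False by simp
qed

theorem theorem1p7:
  shows "\<exists>(H :: (nat \<Rightarrow> complex) hilbert) X (K :: (nat \<Rightarrow> complex) hilbert) Y.
           separable_op_space H X \<and> separable_op_space K Y \<and>
           \<not> isomorphically_embeds H X K Y \<and>
           bounded_almost_completely_coarsely_equivalent H X K Y"
  using separable_coord_space not_isomorphically_embeds_coord_space bounded_equivalence_Suc_id by blast

end
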